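(* For every $n\ge3$, the algebra $\mathcal A_n$ of polynomial absolute joint first-order differential projective invariants of $n$ points is generated by cyclic invariants: $$\mathcal A_n=\mathbb R\bigl[Z_\gamma\mid \gamma\in S_n\text{ is a cycle of length } r\ge2\bigr],$$ where for a cycle $\gamma=(i_1\,i_2\,\dots\,i_r)$ one sets $Z_\gamma=C_{i_1i_2}C_{i_2i_3}\cdots C_{i_{r-1}i_r}C_{i_ri_1}$ and $C_{ij}=p_i(x_j-x_i)+q_i(y_j-y_i)$.
   Context: Let $R_n=\mathbb R[x_i,y_i,p_i,q_i\mid i=1,\dots,n]$. For $T=\begin{pmatrix} a_1 & a_2 & a_3 \\ b_1 & b_2 & b_3 \\ c_1 & c_2 & c_3 \end{pmatrix}\in GL(3,\mathbb R)$ and $g=[T]\in PGL(3,\mathbb R)$, put $s_i=c_1x_i+c_2y_i+c_3$. The element $g$ acts (where all $s_i\ne0$) diagonally on $z=(x_i,y_i,p_i,q_i)_{i=1}^n$ by $(x_i,y_i)\mapsto\left(\frac{a_1x_i+a_2y_i+a_3}{s_i},\frac{b_1x_i+b_2y_i+b_3}{s_i}\right)$, with $(p_i,q_i)$ transforming as the first-order partial derivatives of a scalar function at $(x_i,y_i)$. Equivalently, with $A_i=(x_i,y_i,1)^T$ (column) and $\ell_i=(p_i,q_i,-p_ix_i-q_iy_i)$ (row), the action is $A_i\mapsto TA_i/s_i$, $\ell_i\mapsto s_i\ell_iT^{-1}$; note $C_{ij}=\ell_iA_j$ and $C_{ii}=0$. $\mathcal A_n\subset R_n$ is the algebra of all $F\in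 R_n$ with $F(g\cdot z)=F(z)$ for all $g\in PGL(3,\mathbb R)$ and $z$ for which the action is defined. $S_n$ is the symmetric group on $\{1,\dots,n\}$. *)

theory Defs
  imports "HOL-Analysis.Analysis" "HOL-Library.Poly_Mapping" "HOL-Combinatorics.Cycles"
begin

section \<open>The polynomial ring\<close>

datatype jet_var = Xv nat | Yv nat | Pv nat | Qv nat

text \<open>Polynomials are finitely supported maps from monomials (finitely supported exponent
  functions) to coefficients, with the convolution product of \<^theory>\<open>HOL-Library.Poly_Mapping\<close>.\<close>

type_synonym jet_poly = "(jet_var \<Rightarrow>\<^sub>0 nat) \<Rightarrow>\<^sub>0 real"

definition jet_vars :: "nat \<Rightarrow> jet_var set" where
  "jet_vars n = (\<Union>i\<in>{1..n}. {Xv i, Yv i, Pv i, Qv i})"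

definition jet_ring :: "nat \<Rightarrow> jet_poly set" where
  "jet_ring n = {F. \<forall>m\<in>Poly_Mapping.keys F. Poly_Mapping.keys m \<subseteq> jet_vars n}"

definition pconst :: "real \<Rightarrow> jet_poly" where
  "pconst a = Poly_Mapping.single 0 a"

definition pvar :: "jet_var \<Rightarrow> jet_poly" where
  "pvar v = Poly_Mapping.single (Poly_Mapping.single v 1) 1"

definition peval :: "(jet_var \<Rightarrow> real) \<Rightarrow> jet_poly \<Rightarrow> real" where
  "peval z F = (\<Sum>m\<in>Poly_Mapping.keys F. Poly_Mapping.lookup F m *
      (\<Prod>v\<in>Poly_Mapping.keys m. z v ^ Poly_Mapping.lookup m v))"

inductive_set generated_subalgebra :: "jet_poly set \<Rightarrow> jet_poly set" for S where
  const: "pconst a \<in> generated_subalgebra S"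
| gen: "F \<in> S \<Longrightarrow> F \<in> generated_subalgebra S"
| add: "F \<in> generated_subalgebra S \<Longrightarrow> G \<in> generated_subalgebra S \<Longrightarrow>
    F + G \<in> generated_subalgebra S"
| mult: "F \<in> generated_subalgebra S \<Longrightarrow> G \<in> generated_subalgebra S \<Longrightarrow>
    F * G \<in> generated_subalgebra S"


section \<open>The action of the projective group\<close>

definition GL3 :: "(real^3^3) set" where
  "GL3 = {T. invertible T}"

definition PGL3 :: "(real^3^3) set set" where
  "PGL3 = GL3 // {(T, T'). T \<in> GL3 \<and> T' \<in> GL3 \<and> (\<exists>c. c \<noteq> 0 \<and> T' = c *\<^sub>R T)}"

definition pt :: "(jet_var \<Rightarrow> real) \<Rightarrow> nat \<Rightarrow> real^3" where
  "pt z i = vector [z (Xv i), z (Yv i), 1]"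

definition covec :: "(jet_var \<Rightarrow> real) \<Rightarrow> nat \<Rightarrow> real^3" where
  "covec z i = vector [z (Pv i), z (Qv i), - z (Pv i) * z (Xv i) - z (Qv i) * z (Yv i)]"

definition hscale :: "real^3^3 \<Rightarrow> (jet_var \<Rightarrow> real) \<Rightarrow> nat \<Rightarrow> real" where
  "hscale T z i = T$3$1 * z (Xv i) + T$3$2 * z (Yv i) + T$3$3"

text \<open>The covector \<open>(p, q, - p x - q y)\<close> is multiplied on the right by the inverse matrix and rescaled.
  The first two entries of the result are the transformed partial derivatives; the third is
  determined by them, because the pairing of \<^const>\<open>covec\<close> with \<^const>\<open>pt\<close> stays zero.
  Only configurations with nonzero \<^const>\<open>hscale\<close> at every point are meaningful.\<close>

fun act :: "real^3^3 \<Rightarrow> (jet_var \<Rightarrow> real) \<Rightarrow> jet_var \<Rightarrow> real" where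
  "act T z (Xv i) = (T *v pt z i) $ 1 / hscale T z i"
| "act T z (Yv i) = (T *v pt z i) $ 2 / hscale T z i"
| "act T z (Pv i) = hscale T z i * (covec z i v* matrix_inv T) $ 1"
| "act T z (Qv i) = hscale T z i * (covec z i v* matrix_inv T) $ 2"

lemma matrix_inv_inverse:
  fixes T :: "real^3^3"
  assumes "invertible T"
  shows "T ** matrix_inv T = mat 1" "matrix_inv T ** T = mat 1"
  using assms someI_ex[of "\<lambda>A'. T ** A' = mat 1 \<and> A' ** T = mat 1"]
  unfolding invertible_def matrix_inv_def by blast+

lemma matrix_inv_scaleR:
  fixes T :: "real^3^3"
  assumes "invertible T" "c \<noteq> 0"
  shows "matrix_inv (c *\<^sub>R T) = inverse c *\<^sub>R matrix_inv T"
proof -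
  let ?B = "inverse c *\<^sub>R matrix_inv T"
  have B: "(c *\<^sub>R T) ** ?B = mat 1" "?B ** (c *\<^sub>R T) = mat 1"
    using assms matrix_inv_inverse[OF assms(1)]
    by (simp_all add: scalar_matrix_assoc[symmetric] matrix_scalar_ac)
  then have "invertible (c *\<^sub>R T)"
    unfolding invertible_def by blast
  then have "matrix_inv (c *\<^sub>R T) ** (c *\<^sub>R T) = mat 1"
    by (rule matrix_inv_inverse)
  then show ?thesis
    by (metis B(1) matrix_mul_assoc matrix_mul_lid matrix_mul_rid)
qed

text \<open>The action depends only on the class of the matrix in \<^const>\<open>PGL3\<close>, so quantifying over the
  representatives of a class, as in \<open>joint_invariants\<close> below, is the same as choosing one.\<close>

lemma hscale_scaleR: "hscale (c *\<^sub>R T) z i = c * hscale T z i"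
  by (simp add: hscale_def algebra_simps)

lemma act_scaleR:
  assumes "T \<in> GL3" "c \<noteq> 0"
  shows "act (c *\<^sub>R T) z = act T z"
proof
  fix v
  have inv: "matrix_inv (c *\<^sub>R T) = inverse c *\<^sub>R matrix_inv T"
    using assms by (simp add: GL3_def matrix_inv_scaleR)
  show "act (c *\<^sub>R T) z v = act T z v"
    using assms(2)
    by (cases v) (simp_all add: hscale_scaleR inv scaleR_matrix_vector_assoc[symmetric]
        vector_scaleR_matrix_ac)
qed

text \<open>Coordinates of \<open>z\<close> with index outside \<open>{1..n}\<close> do not affect the value of \<open>F\<close>.\<close>

definition joint_invariants :: "nat \<Rightarrow> jet_poly set" where
  "joint_invariants n = {F \<in> jet_ring n. \<forall>g\<in>PGL3. \<forall>T\<in>g. \<forall>z.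
      (\<forall>i\<in>{1..n}. hscale T z i \<noteq> 0) \<longrightarrow> peval (act T z) F = peval z F}"


section \<open>Cyclic invariants\<close>

definition Cpoly :: "nat \<Rightarrow> nat \<Rightarrow> jet_poly" where
  "Cpoly i j = pvar (Pv i) * (pvar (Xv j) - pvar (Xv i)) + pvar (Qv i) * (pvar (Yv j) - pvar (Yv i))"

definition Zpoly :: "nat list \<Rightarrow> jet_poly" where
  "Zpoly cs = (\<Prod>k<length cs. Cpoly (cs ! k) (cs ! (Suc k mod length cs)))"

text \<open>A cycle in the symmetric group is a permutation \<open>cycle_of_list cs\<close>, where the predicate
  \<open>cycle\<close> of the library only says that the list is distinct; \<open>Zpoly\<close> does not change when the list
  is rotated. As the length is at least 2, every entry of the list is moved and hence lies in
  \<open>{1..n}\<close>.\<close>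

definition cyclic_invariants :: "nat \<Rightarrow> jet_poly set" where
  "cyclic_invariants n = {Zpoly cs | \<gamma> cs. \<gamma> permutes {1..n} \<and> cycle cs \<and> 2 \<le> length cs \<and>
      \<gamma> = cycle_of_list cs}"

end

theory Submission
  imports Defs
begin

text \<open>
  Pass to homogeneous coordinates \<open>A\<^sub>i\<close> (vectors) and \<open>L\<^sub>i\<close> (covectors), on which \<open>GL(3)\<close> acts
  linearly; \<open>F\<close> becomes a function on the incidence variety \<open>L\<^sub>i A\<^sub>i = 0\<close> with poles only where the third
  coordinate of some \<open>A\<^sub>i\<close> vanishes. Applying the permutation matrix that swaps coordinates 1 and 3
  moves the poles to the zeros of the first coordinates, so there are none and \<open>F\<close> lifts to a polynomial
  of equal degree in \<open>A\<^sub>i\<close> and \<open>L\<^sub>i\<close> for every \<open>i\<close>.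

  Let \<open>P\<close> be the lift of \<open>F\<close>, modulo the algebra generated by the cyclic invariants, of least norm for
  the Fischer inner product, in which multiplication by a variable is adjoint to differentiation. The
  operators \<open>D\<^sub>k\<^sub>l\<close> of the infinitesimal action have the adjoints \<open>D\<^sub>l\<^sub>k\<close> and map \<open>P\<close> into the kernel of the
  restriction to the incidence variety, to which \<open>P\<close> is orthogonal, so \<open>P\<close> is an honest \<open>GL(3)\<close> invariant.
  It is also orthogonal to all monomials in the pairings \<open>C\<^sub>i\<^sub>j\<close>, balanced ones being products of cycles.
  By induction on the degree the adjoints \<open>\<Delta>\<^sub>i\<^sub>j\<close> of multiplication by \<open>C\<^sub>i\<^sub>j\<close> kill \<open>P\<close>, and
  \<open>0 = \<langle>P, \<Sum> C\<^sub>i\<^sub>j \<Delta>\<^sub>i\<^sub>j P\<rangle> = \<Sum> \<parallel>X\<^sub>l\<^sub>k P\<parallel>\<^sup>2\<close> with the polarization operators \<open>X\<^sub>k\<^sub>l\<close> on the vectors, which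
  forces \<open>P = 0\<close>.
\<close>

section \<open>Polynomials over an arbitrary set of variables\<close>

abbreviation "lookup \<equiv> Poly_Mapping.lookup"
abbreviation "keys \<equiv> Poly_Mapping.keys"
abbreviation "single \<equiv> Poly_Mapping.single"

type_synonym 'v mpoly = "('v \<Rightarrow>\<^sub>0 nat) \<Rightarrow>\<^sub>0 real"

definition var :: "'v \<Rightarrow> 'v mpoly" where
  "var v = single (single v 1) 1"

definition cst :: "real \<Rightarrow> 'v mpoly" where
  "cst c = single 0 c"

lemma single_eq_sum: "F = (\<Sum>m\<in>keys F. single m (lookup F m))" for F :: "'a \<Rightarrow>\<^sub>0 real"
proof (rule poly_mapping_eqI)
  fix k
  have "lookup (\<Sum>m\<in>keys F. single m (lookup F m)) k = (\<Sum>m\<in>keys F. if m = k then lookup F m else 0)"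
    by (auto simp: lookup_sum lookup_single when_def intro!: sum.cong)
  also have "\<dots> = lookup F k"
    by (simp add: in_keys_iff)
  finally show "lookup F k = lookup (\<Sum>m\<in>keys F. single m (lookup F m)) k" by simp
qed

text \<open>Reduces additive statements to single terms while a condition on the support stays
  available. The case of \<open>0\<close> is separate because \<open>K\<close> may be empty.\<close>

lemma mpoly_induct_keys [consumes 1, case_names single add]:
  fixes F :: "'a \<Rightarrow>\<^sub>0 real"
  assumes "keys F \<subseteq> K"
    and "\<And>m c. m \<in> K \<Longrightarrow> P (single m c)"
    and "\<And>F G. P F \<Longrightarrow> P G \<Longrightarrow> P (F + G)"
    and "P 0"
  shows "P F"
proof -
  have "P (\<Sum>m\<in>M. single m (lookup F m))" if "finite M" "M \<subseteq> K" for M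
    using that by (induction M rule: finite_induct) (auto intro: assms)
  from this[OF finite_keys assms(1)] show ?thesis
    using single_eq_sum[of F] by simp
qed

lemma mpoly_induct [case_names single add]:
  fixes F :: "'a \<Rightarrow>\<^sub>0 real"
  assumes single: "\<And>m c. P (single m c)"
    and add: "\<And>F G. P F \<Longrightarrow> P G \<Longrightarrow> P (F + G)"
  shows "P F"
proof -
  have "P 0" using single[of undefined 0] by simp
  then show ?thesis
    using mpoly_induct_keys[of F UNIV P] assms by simp
qed

lemma cst_mult_single: "cst c * single m d = single m (c * d)"
  by (simp add: cst_def mult_single)

lemma lookup_cst_mult [simp]: "lookup (cst c * F) m = c * lookup F m"
  by (induction F rule: mpoly_induct)
    (auto simp: cst_mult_single lookup_single when_def lookup_add distrib_left)

lemma lookup_single_mult: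
  fixes F :: "('a::cancel_comm_monoid_add) \<Rightarrow>\<^sub>0 real"
  shows "lookup (single k c * F) (k + m) = c * lookup F m"
  by (induction F rule: mpoly_induct)
    (auto simp: mult_single lookup_single when_def lookup_add distrib_left)

lemma keys_single_mult:
  fixes F :: "'a::cancel_comm_monoid_add \<Rightarrow>\<^sub>0 real"
  assumes "c \<noteq> 0"
  shows "keys (single k c * F) = (+) k ` keys F"
proof
  show "keys (single k c * F) \<subseteq> (+) k ` keys F"
    using keys_mult[of "single k c" F] assms by auto
  show "(+) k ` keys F \<subseteq> keys (single k c * F)"
    using assms by (auto simp: in_keys_iff lookup_single_mult)
qed

text \<open>Multiplication by a monomial shifts the support injectively, so it can be cancelled.
  Monomial denominators are removed with this below.\<close>

lemma single_mult_eq_0_iff: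
  fixes F :: "'a::cancel_comm_monoid_add \<Rightarrow>\<^sub>0 real"
  assumes "c \<noteq> 0"
  shows "single k c * F = 0 \<longleftrightarrow> F = 0"
  using keys_single_mult[OF assms, of k F] by (metis image_is_empty keys_eq_empty)

lemma keys_cst_mult: "keys (cst c * F) \<subseteq> keys F"
  by (auto simp: in_keys_iff)

lemma keys_diff_subset: "keys (a - b) \<subseteq> keys a \<union> keys b"
  by (auto simp: in_keys_iff lookup_minus)

lemma keys_sum_subset_UN: "keys (sum f A) \<subseteq> (\<Union>a\<in>A. keys (f a))"
  for f :: "'b \<Rightarrow> 'a \<Rightarrow>\<^sub>0 'c::comm_monoid_add"
  by (induction A rule: infinite_finite_induct) (use keys_add in fastforce)+

lemma keys_var_mult: "keys (var v * F) = (+) (single v 1) ` keys F"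
  by (simp add: var_def keys_single_mult)

subsection \<open>Evaluation\<close>

definition meval :: "('v \<Rightarrow> real) \<Rightarrow> ('v \<Rightarrow>\<^sub>0 nat) \<Rightarrow> real" where
  "meval z m = (\<Prod>v\<in>keys m. z v ^ lookup m v)"

definition eval :: "('v \<Rightarrow> real) \<Rightarrow> 'v mpoly \<Rightarrow> real" where
  "eval z F = (\<Sum>m\<in>keys F. lookup F m * meval z m)"

lemma meval_superset:
  assumes "finite A" "keys m \<subseteq> A"
  shows "meval z m = (\<Prod>v\<in>A. z v ^ lookup m v)"
  unfolding meval_def using assms
  by (intro prod.mono_neutral_left) (auto simp: in_keys_iff)

lemma meval_0 [simp]: "meval z 0 = 1"
  by (simp add: meval_def)

lemma meval_single [simp]: "meval z (single v k) = z v ^ k"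
  by (simp add: meval_def)

lemma meval_add: "meval z (m + m') = meval z m * meval z m'"
  using meval_superset[of "keys m \<union> keys m'" m z] meval_superset[of "keys m \<union> keys m'" m' z]
    meval_superset[of "keys m \<union> keys m'" "m + m'" z] keys_add[of m m']
  by (simp add: lookup_add power_add prod.distrib)

lemma meval_sum: "meval z (sum f A) = (\<Prod>a\<in>A. meval z (f a))"
  by (induction A rule: infinite_finite_induct) (auto simp: meval_add)

lemma eval_superset:
  assumes "finite A" "keys F \<subseteq> A"
  shows "eval z F = (\<Sum>m\<in>A. lookup F m * meval z m)"
  unfolding eval_def using assms
  by (intro sum.mono_neutral_left) (auto simp: in_keys_iff)

lemma eval_single [simp]: "eval z (single m c) = c * meval z m"
  by (simp add: eval_def)

lemma eval_0 [simp]: "eval z 0 = 0"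
  by (simp add: eval_def)

lemma eval_cst [simp]: "eval z (cst c) = c"
  by (simp add: cst_def)

lemma eval_var [simp]: "eval z (var v) = z v"
  by (simp add: var_def)

lemma eval_1 [simp]: "eval z 1 = 1"
  using eval_cst[of z 1] by (simp add: cst_def)

lemma eval_add [simp]: "eval z (F + G) = eval z F + eval z G"
  using eval_superset[of "keys F \<union> keys G" F z] eval_superset[of "keys F \<union> keys G" G z]
    eval_superset[of "keys F \<union> keys G" "F + G" z] keys_add[of F G]
  by (simp add: lookup_add distrib_right sum.distrib)

lemma eval_sum [simp]: "eval z (sum f A) = (\<Sum>a\<in>A. eval z (f a))"
  by (induction A rule: infinite_finite_induct) auto

lemma eval_uminus [simp]: "eval z (- F) = - eval z F"
  by (simp add: eval_def sum_negf)

lemma eval_diff [simp]: "eval z (F - G) = eval z F - eval z G"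
  using eval_add[of z F "- G"] by simp

lemma eval_mult [simp]: "eval z (F * G) = eval z F * eval z G"
proof (induction F rule: mpoly_induct)
  case (single m c)
  show ?case
    by (induction G rule: mpoly_induct)
      (auto simp: mult_single meval_add distrib_left)
qed (auto simp: distrib_right)

lemma eval_prod [simp]: "eval z (prod f A) = (\<Prod>a\<in>A. eval z (f a))"
  by (induction A rule: infinite_finite_induct) auto

lemma eval_cong:
  assumes "\<And>m v. m \<in> keys F \<Longrightarrow> v \<in> keys m \<Longrightarrow> z v = z' v"
  shows "eval z F = eval z' F"
  using assms by (auto simp: eval_def meval_def intro!: sum.cong prod.cong)


subsection \<open>Partial derivatives\<close>

text \<open>Given by coefficients: exactly one monomial of \<open>F\<close> contributes to each
  monomial of the derivative. Additivity and commutation are then read off coefficientwise.\<close>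

definition pd :: "'v \<Rightarrow> 'v mpoly \<Rightarrow> 'v mpoly" where
  "pd v F = Abs_poly_mapping (\<lambda>m. real (lookup m v + 1) * lookup F (m + single v 1))"

lemma lookup_pd: "lookup (pd v F) m = real (lookup m v + 1) * lookup F (m + single v 1)"
proof -
  have "finite ((\<lambda>m. m + single v 1) -` keys F)"
    by (rule finite_vimageI) (auto intro: injI)
  then have "finite {m. real (lookup m v + 1) * lookup F (m + single v 1) \<noteq> 0}"
    by (rule rev_finite_subset) (auto simp: in_keys_iff)
  then show ?thesis unfolding pd_def by simp
qed

lemma pd_add: "pd v (F + G) = pd v F + pd v G"
  by (rule poly_mapping_eqI) (simp add: lookup_pd lookup_add algebra_simps)

lemma pd_0 [simp]: "pd v 0 = 0"
  by (rule poly_mapping_eqI) (simp add: lookup_pd)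

lemma pd_sum: "pd v (sum f A) = (\<Sum>a\<in>A. pd v (f a))"
  by (induction A rule: infinite_finite_induct) (auto simp: pd_add)

lemma pd_commute: "pd u (pd v F) = pd v (pd u F)"
  by (rule poly_mapping_eqI) (auto simp: lookup_pd lookup_add lookup_single when_def add_ac)

lemma pd_single: "pd v (single m c) = single (m - single v 1) (real (lookup m v) * c)"
proof (rule poly_mapping_eqI)
  fix k
  show "lookup (pd v (single m c)) k = lookup (single (m - single v 1) (real (lookup m v) * c)) k"
  proof (cases "lookup m v = 0")
    case True
    then have "m \<noteq> k + single v 1" by (auto simp: lookup_add)
    then show ?thesis using True by (simp add: lookup_pd lookup_single)
  next
    case False
    then have m: "m = (m - single v 1) + single v 1"
      by (auto intro!: poly_mapping_eqI simp: lookup_add lookup_minus lookup_single when_def)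
    then have "m = k + single v 1 \<longleftrightarrow> m - single v 1 = k"
      by (metis add_right_cancel)
    then show ?thesis using False
      by (auto simp: lookup_pd lookup_single when_def lookup_add lookup_minus)
  qed
qed

lemma keys_pd: "keys (pd v F) \<subseteq> {m. m + single v 1 \<in> keys F}"
  by (auto simp: in_keys_iff lookup_pd)

lemma pd_var_mult: "pd u (var v * F) = var v * pd u F + (if u = v then F else 0)"
proof (induction F rule: mpoly_induct)
  case (single m c)
  show ?case
  proof (cases "lookup m u = 0")
    case True
    then show ?thesis
      by (auto simp: var_def mult_single pd_single lookup_add lookup_single when_def)
  next
    case False
    then have m: "single v 1 + m - single u 1 = single v 1 + (m - single u 1)"
      by (auto intro!: poly_mapping_eqI simp: lookup_add lookup_minus lookup_single when_def)
    have "single u 1 + (m - single u 1) = m" using False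
      by (auto intro!: poly_mapping_eqI simp: lookup_add lookup_minus lookup_single when_def)
    then show ?thesis using m
      by (auto simp: var_def mult_single pd_single lookup_add lookup_single when_def
          single_add [symmetric] algebra_simps)
  qed
next
  case (add F G)
  then show ?case by (auto simp: pd_add algebra_simps)
qed

text \<open>The Euler operator of one variable is diagonal on monomials. Its eigenvalues are the
  exponents, so its vanishing later controls which variables occur.\<close>

lemma var_mult_pd_lookup: "lookup (var v * pd v F) m = real (lookup m v) * lookup F m"
proof (induction F rule: mpoly_induct)
  case (single k c)
  have "single v 1 + (k - single v 1) = k" if "lookup k v \<noteq> 0" using that
    by (auto intro!: poly_mapping_eqI simp: lookup_add lookup_minus lookup_single when_def)
  then show ?case
    by (cases "lookup k v = 0") (auto simp: pd_single var_def mult_single lookup_single when_def)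
qed (auto simp: pd_add distrib_left lookup_add)

section \<open>Total degree of monomials and induction over them\<close>

definition mdeg :: "('v \<Rightarrow>\<^sub>0 nat) \<Rightarrow> nat" where
  "mdeg m = (\<Sum>v\<in>keys m. lookup m v)"

lemma mdeg_superset: "finite A \<Longrightarrow> keys m \<subseteq> A \<Longrightarrow> mdeg m = (\<Sum>v\<in>A. lookup m v)"
  unfolding mdeg_def by (intro sum.mono_neutral_left) (auto simp: in_keys_iff)

lemma mdeg_add [simp]: "mdeg (m + m') = mdeg m + mdeg m'"
  using mdeg_superset[of "keys m \<union> keys m'" m] mdeg_superset[of "keys m \<union> keys m'" m']
    mdeg_superset[of "keys m \<union> keys m'" "m + m'"] keys_add[of m m']
  by (simp add: lookup_add sum.distrib)

lemma mdeg_single [simp]: "mdeg (single v k) = k"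
  by (simp add: mdeg_def)

lemma mdeg_zero [simp]: "mdeg 0 = 0"
  by (simp add: mdeg_def)

lemma mdeg_eq_0_iff [simp]: "mdeg m = 0 \<longleftrightarrow> m = 0"
  by (auto simp: mdeg_def in_keys_iff intro: poly_mapping_eqI)

lemma monom_induct [consumes 1, case_names zero add]:
  fixes m :: "'v \<Rightarrow>\<^sub>0 nat"
  assumes "keys m \<subseteq> V" and "P 0"
    and "\<And>m v. P m \<Longrightarrow> v \<in> V \<Longrightarrow> keys m \<subseteq> V \<Longrightarrow> P (single v 1 + m)"
  shows "P m"
  using assms(1)
proof (induction "mdeg m" arbitrary: m)
  case 0
  then show ?case using assms(2) by simp
next
  case (Suc k)
  then obtain v where v: "v \<in> keys m"
    by (metis mdeg_eq_0_iff keys_eq_empty ex_in_conv nat.distinct(1))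
  let ?m = "m - single v 1"
  have m: "single v 1 + ?m = m" using v
    by (auto intro!: poly_mapping_eqI simp: lookup_add lookup_minus lookup_single when_def in_keys_iff)
  have "keys ?m \<subseteq> V" using Suc.prems
    by (auto simp: in_keys_iff lookup_minus subset_iff)
  moreover have "mdeg m = 1 + mdeg ?m" using m by (metis mdeg_add mdeg_single)
  ultimately have "P ?m" using Suc by simp
  then have "P (single v 1 + ?m)" using v Suc.prems \<open>keys ?m \<subseteq> V\<close> by (intro assms(3)) auto
  then show ?case using m by simp
qed

lemma finite_monoms:
  assumes "finite V"
  shows "finite {m. keys m \<subseteq> V \<and> mdeg m \<le> N}"
proof -
  let ?S = "{f. \<forall>v. (v \<in> V \<longrightarrow> f v \<in> {..N}) \<and> (v \<notin> V \<longrightarrow> f v = 0)}"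
  have "finite ?S" using assms by (intro finite_set_of_finite_funs) auto
  moreover have "lookup ` {m. keys m \<subseteq> V \<and> mdeg m \<le> N} \<subseteq> ?S"
  proof clarify
    fix m v assume m: "keys m \<subseteq> V" "mdeg m \<le> N"
    have "lookup m v \<le> mdeg m"
      unfolding mdeg_def using member_le_sum[of v "keys m" "lookup m"]
      by (cases "v \<in> keys m") (auto simp: in_keys_iff)
    then show "(v \<in> V \<longrightarrow> lookup m v \<in> {..N}) \<and> (v \<notin> V \<longrightarrow> lookup m v = 0)"
      using m by (auto simp: in_keys_iff)
  qed
  moreover have "inj_on lookup {m. keys m \<subseteq> V \<and> mdeg m \<le> N}"
    by (auto intro!: inj_onI simp: poly_mapping_eqI)
  ultimately show ?thesis by (meson finite_imageD finite_subset)
qed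

text \<open>The chain rule along a curve \<open>\<phi>\<close>. It serves for partial derivatives,
  for continuity in one variable and for the infinitesimal group action.\<close>

lemma eval_has_derivative:
  assumes "finite V" "\<And>m. m \<in> keys F \<Longrightarrow> keys m \<subseteq> V"
    and d: "\<And>v. v \<in> V \<Longrightarrow> (\<phi> v has_real_derivative \<phi>' v) (at t)"
  shows "((\<lambda>s. eval (\<lambda>v. \<phi> v s) F) has_real_derivative
    (\<Sum>v\<in>V. \<phi>' v * eval (\<lambda>v. \<phi> v t) (pd v F))) (at t)"
proof -
  have "keys F \<subseteq> {m. keys m \<subseteq> V}" using assms(2) by auto
  then show ?thesis
  proof (induction F rule: mpoly_induct_keys)
    case (single m c)
    then have "keys m \<subseteq> V" by simp
    then show ?case
    proof (induction m rule: monom_induct)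
      case zero
      have "pd v (single 0 c) = 0" for v :: 'a by (simp add: pd_single)
      then show ?case by simp
    next
      case (add m v)
      have e: "single (single v 1 + m) c = var v * single m c"
        by (simp add: var_def mult_single)
      have "(\<Sum>u\<in>V. \<phi>' u * (if u = v then eval (\<lambda>v. \<phi> v t) (single m c) else 0))
          = \<phi>' v * eval (\<lambda>v. \<phi> v t) (single m c)"
        using add.hyps assms(1) by (simp add: if_distrib cong: if_cong)
      then have "(\<Sum>u\<in>V. \<phi>' u * eval (\<lambda>v. \<phi> v t) (pd u (var v * single m c)))
          = \<phi>' v * eval (\<lambda>v. \<phi> v t) (single m c)
           + (\<Sum>u\<in>V. \<phi>' u * eval (\<lambda>v. \<phi> v t) (pd u (single m c))) * \<phi> v t"
        by (simp add: pd_var_mult algebra_simps sum.distrib sum_distrib_left if_distrib [of "eval _"]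
            cong: if_cong del: eval_single)
      then show ?case
        unfolding e eval_mult eval_var
        using DERIV_mult[OF d[OF add.hyps(1)] add.IH] by (simp del: eval_single)
    qed
  next
    case (add F G)
    then show ?case
      using DERIV_add[OF add] by (simp add: pd_add distrib_left sum.distrib)
  qed simp
qed

lemma pd_zero_imp_cst:
  assumes "\<And>v. pd v F = 0"
  shows "F = cst (lookup F 0)"
proof (rule poly_mapping_eqI)
  fix m
  show "lookup F m = lookup (cst (lookup F 0)) m"
  proof (cases "m = 0")
    case False
    then obtain v where v: "lookup m v \<noteq> 0" by (metis poly_mapping_eqI lookup_zero)
    have "real (lookup m v) * lookup F m = 0"
      using var_mult_pd_lookup[of v F m] assms[of v] by simp
    then show ?thesis using v False by (simp add: cst_def lookup_single)
  qed (simp add: cst_def)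
qed

text \<open>Induction on a degree bound: the partial derivatives vanish everywhere too, hence are
  zero, which leaves a constant with value zero. The set of variables may be infinite.\<close>

lemma eval_zero_imp_zero:
  assumes "\<And>z. eval z F = 0"
  shows "F = (0 :: 'v mpoly)"
proof -
  have "F = 0" if "\<forall>m\<in>keys F. mdeg m \<le> N" "\<forall>z. eval z F = 0" for N
    using that
  proof (induction N arbitrary: F)
    case 0
    then have "keys F \<subseteq> {0}" by auto
    then have "F = cst (lookup F 0)"
      by (intro poly_mapping_eqI) (auto simp: cst_def lookup_single when_def in_keys_iff)
    then show ?case using 0 by (metis eval_cst cst_def single_zero)
  next
    case (Suc N)
    have "pd v F = 0" for v
    proof (rule Suc.IH)
      show "\<forall>m\<in>keys (pd v F). mdeg m \<le> N"
      proof
        fix m assume "m \<in> keys (pd v F)"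
        then have "m + single v 1 \<in> keys F" using keys_pd[of v F] by auto
        then have "mdeg (m + single v 1) \<le> Suc N" by (rule bspec[OF Suc.prems(1)])
        then show "mdeg m \<le> N" by simp
      qed
      show "\<forall>z. eval z (pd v F) = 0"
      proof
        fix z :: "'v \<Rightarrow> real"
        \<comment> \<open>Inserting \<open>v\<close> keeps its term in the sum over \<open>V\<close>
          even when \<open>v\<close> does not occur in \<open>F\<close>.\<close>
        define V where "V = insert v (\<Union>m\<in>keys F. keys m)"
        have V: "finite V" "v \<in> V" "\<And>m. m \<in> keys F \<Longrightarrow> keys m \<subseteq> V" by (auto simp: V_def)
        have "((\<lambda>s. eval (\<lambda>u. (if u = v then s else z u)) F) has_real_derivative
          (\<Sum>u\<in>V. (if u = v then 1 else 0) * eval (\<lambda>u. (if u = v then z v else z u)) (pd u F))) (at (z v))"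
          by (rule eval_has_derivative) (use V in auto)
        moreover have "(\<Sum>u\<in>V. (if u = v then 1 else 0) * eval (\<lambda>u. (if u = v then z v else z u)) (pd u F))
          = eval z (pd v F)"
        proof -
          have "(\<lambda>u. (if u = v then z v else z u)) = z" by auto
          then show ?thesis using V by (simp add: if_distrib[of "\<lambda>x. x * _"] cong: if_cong)
        qed
        ultimately have "((\<lambda>s. 0) has_real_derivative eval z (pd v F)) (at (z v))"
          using Suc.prems(2) by simp
        then show "eval z (pd v F) = 0"
          using DERIV_unique DERIV_const by blast
      qed
    qed
    then have "F = cst (lookup F 0)" by (rule pd_zero_imp_cst)
    then show ?case using Suc.prems(2) by (metis eval_cst cst_def single_zero)
  qed
  moreover have "\<forall>m\<in>keys F. mdeg m \<le> Max (mdeg ` keys F)" by simp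
  ultimately show ?thesis using assms by blast
qed


section \<open>The Fischer inner product\<close>

definition mfact :: "('v \<Rightarrow>\<^sub>0 nat) \<Rightarrow> real" where
  "mfact m = (\<Prod>v\<in>keys m. fact (lookup m v))"

lemma mfact_superset: "finite A \<Longrightarrow> keys m \<subseteq> A \<Longrightarrow> mfact m = (\<Prod>v\<in>A. fact (lookup m v))"
  unfolding mfact_def by (intro prod.mono_neutral_left) (auto simp: in_keys_iff)

lemma mfact_pos: "mfact m > 0"
  unfolding mfact_def by (rule prod_pos) auto

lemma mfact_add_single: "mfact (m + single v 1) = real (lookup m v + 1) * mfact m"
proof -
  let ?A = "insert v (keys m)"
  have "mfact (m + single v 1) = (\<Prod>u\<in>?A. fact (lookup (m + single v 1) u))"
    using keys_add[of m "single v 1"] by (intro mfact_superset) auto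
  also have "\<dots> = fact (lookup m v + 1) * (\<Prod>u\<in>?A - {v}. fact (lookup (m + single v 1) u))"
    by (subst prod.remove[of _ v]) (auto simp: lookup_add)
  also have "(\<Prod>u\<in>?A - {v}. fact (lookup (m + single v 1) u)) = (\<Prod>u\<in>?A - {v}. fact (lookup m u) :: real)"
    by (intro prod.cong) (auto simp: lookup_add lookup_single)
  also have "fact (lookup m v + 1) * \<dots> = real (lookup m v + 1) * (\<Prod>u\<in>?A. fact (lookup m u))"
    by (subst (2) prod.remove[of _ v]) (auto simp: algebra_simps)
  also have "(\<Prod>u\<in>?A. fact (lookup m u)) = mfact m"
    by (rule mfact_superset[symmetric]) auto
  finally show ?thesis .
qed

text \<open>Monomials are orthogonal with squared norm the multi-index factorial
  \<open>mfact m\<close>. This weight makes multiplication and differentiation adjoint.\<close>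

definition fischer :: "'v mpoly \<Rightarrow> 'v mpoly \<Rightarrow> real" where
  "fischer P Q = (\<Sum>m\<in>keys P. lookup P m * lookup Q m * mfact m)"

lemma fischer_superset:
  assumes "finite A" "keys P \<subseteq> A"
  shows "fischer P Q = (\<Sum>m\<in>A. lookup P m * lookup Q m * mfact m)"
  unfolding fischer_def using assms
  by (intro sum.mono_neutral_left) (auto simp: in_keys_iff)

lemma fischer_sym: "fischer P Q = fischer Q P"
  using fischer_superset[of "keys P \<union> keys Q" P Q] fischer_superset[of "keys P \<union> keys Q" Q P]
  by (simp add: mult_ac)

lemma fischer_single: "fischer (single m c) Q = c * lookup Q m * mfact m"
  by (simp add: fischer_def)

lemma fischer_add_right: "fischer P (Q + R) = fischer P Q + fischer P R"
  by (simp add: fischer_def lookup_add algebra_simps sum.distrib)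

lemma fischer_add_left: "fischer (Q + R) P = fischer Q P + fischer R P"
  using fischer_add_right fischer_sym by metis

lemma fischer_diff_right: "fischer P (Q - R) = fischer P Q - fischer P R"
  by (simp add: fischer_def lookup_minus algebra_simps sum_subtractf)

lemma fischer_diff_left: "fischer (Q - R) P = fischer Q P - fischer R P"
  using fischer_diff_right fischer_sym by metis

lemma fischer_zero [simp]: "fischer P 0 = 0" "fischer 0 P = 0"
  by (simp_all add: fischer_def)

lemma fischer_sum_right: "fischer P (sum f A) = (\<Sum>a\<in>A. fischer P (f a))"
  by (induction A rule: infinite_finite_induct) (auto simp: fischer_add_right)

lemma fischer_sum_left: "fischer (sum f A) P = (\<Sum>a\<in>A. fischer (f a) P)"
  by (induction A rule: infinite_finite_induct) (auto simp: fischer_add_left)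

lemma fischer_cst_right: "fischer P (cst c * Q) = c * fischer P Q"
  unfolding fischer_def lookup_cst_mult by (simp only: sum_distrib_left mult_ac)

lemma fischer_cst_left: "fischer (cst c * P) Q = c * fischer P Q"
  using fischer_cst_right fischer_sym by metis

lemma fischer_nonneg: "fischer P P \<ge> 0"
  unfolding fischer_def by (intro sum_nonneg) (auto intro: mult_nonneg_nonneg less_imp_le[OF mfact_pos])

lemma fischer_eq_0: "fischer P P = 0 \<Longrightarrow> P = 0"
proof -
  assume "fischer P P = 0"
  then have "\<forall>m\<in>keys P. lookup P m * lookup P m * mfact m = 0"
    unfolding fischer_def
    by (subst (asm) sum_nonneg_eq_0_iff) (auto intro: mult_nonneg_nonneg less_imp_le[OF mfact_pos])
  then have "keys P = {}" using mfact_pos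
    by (metis ex_in_conv in_keys_iff less_irrefl mult_eq_0_iff)
  then show ?thesis by simp
qed

text \<open>Raising the exponent of \<open>v\<close> by one multiplies the factorial by the new
  exponent, which is the factor produced by differentiation.\<close>

lemma fischer_var: "fischer (var v * P) Q = fischer P (pd v Q)"
proof (induction P rule: mpoly_induct)
  case (single m c)
  show ?case
    using mfact_add_single[of m v]
    by (simp add: var_def mult_single fischer_single lookup_pd add.commute[of "single v 1" m] mult_ac)
qed (auto simp: distrib_left fischer_add_left)

lemma fischer_pd: "fischer (pd v P) Q = fischer P (var v * Q)"
  using fischer_var fischer_sym by metis


section \<open>Orthogonal projection onto finite-dimensional spaces of polynomials\<close>

lemma cst_1 [simp]: "cst 1 = 1"
  by (simp add: cst_def)

lemma cst_add: "cst (a + b) = cst a + cst b"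
  by (simp add: cst_def single_add)

lemma cst_mult: "cst (a * b) = cst a * cst b"
  by (simp add: cst_def mult_single)

interpretation mpoly: vector_space "\<lambda>c (F :: 'v mpoly). cst c * F"
  by unfold_locales (auto simp: distrib_left cst_add distrib_right cst_mult mult.assoc)

text \<open>One Gram-Schmidt step per generator: \<open>b\<close> is first made orthogonal to the
  span of \<open>B\<close>, then the component of \<open>P - p\<close> along the result is
  removed.\<close>

lemma fischer_projection_finite:
  fixes P :: "'v mpoly"
  assumes "finite B"
  shows "\<exists>P0\<in>mpoly.span B. \<forall>Q\<in>mpoly.span B. fischer (P - P0) Q = 0"
  using assms
proof (induction B arbitrary: P rule: finite_induct)
  case empty
  then show ?case by simp
next
  case (insert b B)
  obtain p where p: "p \<in> mpoly.span B" "\<And>Q. Q \<in> mpoly.span B \<Longrightarrow> fischer (P - p) Q = 0"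
    using insert.IH[of P] by blast
  obtain r where r: "r \<in> mpoly.span B" "\<And>Q. Q \<in> mpoly.span B \<Longrightarrow> fischer (b - r) Q = 0"
    using insert.IH[of b] by blast
  define b' where "b' = b - r"
  \<comment> \<open>If \<open>b\<close> already lies in the span, then \<open>b' = 0\<close> and
    division by zero gives \<open>c = 0\<close>, which is still consistent with the equation for
    \<open>c\<close> below.\<close>
  define c where "c = fischer (P - p) b' / fischer b' b'"
  have mono: "mpoly.span B \<subseteq> mpoly.span (insert b B)"
    by (rule mpoly.span_mono) auto
  have b': "b' \<in> mpoly.span (insert b B)"
    unfolding b'_def using r(1) mono by (intro mpoly.span_diff) (auto intro: mpoly.span_base)
  have c: "fischer (P - p) b' = c * fischer b' b'"
    using fischer_eq_0[of b'] by (cases "fischer b' b' = 0") (auto simp: c_def)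
  show ?case
  proof (intro bexI ballI)
    show "p + cst c * b' \<in> mpoly.span (insert b B)"
      using p(1) mono b' by (intro mpoly.span_add mpoly.span_scale) auto
    fix Q assume "Q \<in> mpoly.span (insert b B)"
    then obtain k where k: "Q - cst k * b \<in> mpoly.span B"
      by (auto simp: mpoly.span_insert)
    define R where "R = Q - cst k * b + cst k * r"
    have R: "R \<in> mpoly.span B"
      unfolding R_def using k r(1) by (intro mpoly.span_add mpoly.span_scale)
    have Q: "Q = R + cst k * b'" by (simp add: R_def b'_def algebra_simps)
    have "fischer b' R = 0" using r(2)[OF R] by (simp add: b'_def)
    then have "fischer (P - (p + cst c * b')) Q = fischer (P - p) R + k * (fischer (P - p) b' - c * fischer b' b')"
      unfolding Q fischer_add_right fischer_diff_left fischer_add_left fischer_cst_left fischer_cst_right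
      by (simp add: algebra_simps)
    then show "fischer (P - (p + cst c * b')) Q = 0"
      using p(2)[OF R] c by simp
  qed
qed

text \<open>A common finite support makes \<open>U\<close> finite-dimensional, so a maximal
  independent subset is a finite spanning set.\<close>

lemma fischer_projection:
  fixes U :: "'v mpoly set"
  assumes M: "finite M" "\<And>Q. Q \<in> U \<Longrightarrow> keys Q \<subseteq> M"
    and U: "mpoly.subspace U"
  obtains P0 where "P0 \<in> U" "\<And>Q. Q \<in> U \<Longrightarrow> fischer (P - P0) Q = 0"
proof -
  obtain B where B: "B \<subseteq> U" "\<not> mpoly.dependent B" "U \<subseteq> mpoly.span B"
    using mpoly.maximal_independent_subset[of U] by blast
  have "Q \<in> mpoly.span ((\<lambda>m. single m 1) ` M)" if "Q \<in> U" for Q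
    using M(2)[OF that]
  proof (induction Q rule: mpoly_induct_keys)
    case (single m c)
    then have "cst c * single m 1 \<in> mpoly.span ((\<lambda>m. single m 1) ` M)"
      by (intro mpoly.span_scale mpoly.span_base) auto
    then show ?case by (simp add: cst_def mult_single)
  qed (auto intro: mpoly.span_add mpoly.span_zero)
  then have "finite B"
    using mpoly.independent_span_bound[OF finite_imageI[OF M(1)] B(2)] B(1) by blast
  from fischer_projection_finite[OF this, of P] obtain P0
    where "P0 \<in> mpoly.span B" "\<forall>Q\<in>mpoly.span B. fischer (P - P0) Q = 0" by blast
  moreover have "mpoly.span B = U"
    using B U by (metis mpoly.span_minimal subset_antisym)
  ultimately show ?thesis using that by blast
qed


section \<open>Invariants of vectors and covectors\<close>

datatype 'k hvar = Vec 'k nat | Cov 'k nat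

text \<open>Here \<open>k\<close> and \<open>l\<close> are coordinates and the sum runs over the
  points: the elementary matrices act on the vectors. \<open>Yop\<close> does the same for
  covectors; the sign and transposition of the dual action enter only in \<open>Dop\<close>.\<close>

definition Xop :: "nat set \<Rightarrow> 'k \<Rightarrow> 'k \<Rightarrow> 'k hvar mpoly \<Rightarrow> 'k hvar mpoly" where
  "Xop I k l P = (\<Sum>j\<in>I. var (Vec k j) * pd (Vec l j) P)"

definition Yop :: "nat set \<Rightarrow> 'k \<Rightarrow> 'k \<Rightarrow> 'k hvar mpoly \<Rightarrow> 'k hvar mpoly" where
  "Yop I k l P = (\<Sum>i\<in>I. var (Cov k i) * pd (Cov l i) P)"

definition pairing :: "nat \<Rightarrow> nat \<Rightarrow> ('k::finite) hvar mpoly" where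
  "pairing i j = (\<Sum>k\<in>UNIV. var (Cov k i) * var (Vec k j))"

definition polar :: "nat \<Rightarrow> nat \<Rightarrow> ('k::finite) hvar mpoly \<Rightarrow> 'k hvar mpoly" where
  "polar i j P = (\<Sum>k\<in>UNIV. pd (Cov k i) (pd (Vec k j) P))"

definition hvars :: "nat set \<Rightarrow> 'k hvar set" where
  "hvars I = (\<Union>k. Vec k ` I \<union> Cov k ` I)"

lemma fischer_Xop: "fischer (Xop I k l P) Q = fischer P (Xop I l k Q)"
  by (simp add: Xop_def fischer_sum_left fischer_sum_right fischer_var fischer_pd)

lemma fischer_Yop: "fischer (Yop I k l P) Q = fischer P (Yop I l k Q)"
  by (simp add: Yop_def fischer_sum_left fischer_sum_right fischer_var fischer_pd)

lemma fischer_pairing: "fischer (pairing i j * P) Q = fischer P (polar i j Q)"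
  by (simp add: pairing_def polar_def sum_distrib_right fischer_sum_left fischer_sum_right
      mult.assoc fischer_var pd_commute[of "Cov _ _"])

lemma sum_swap4:
  "(\<Sum>i\<in>I. \<Sum>j\<in>J. \<Sum>k\<in>K. \<Sum>l\<in>L. f i j k l) = (\<Sum>k\<in>K. \<Sum>l\<in>L. \<Sum>j\<in>J. \<Sum>i\<in>I. f i j k l)"
proof -
  define g where "g j i = (\<Sum>(k,l)\<in>K\<times>L. f i j k l)" for i j
  have "(\<Sum>i\<in>I. \<Sum>j\<in>J. \<Sum>k\<in>K. \<Sum>l\<in>L. f i j k l) = (\<Sum>i\<in>I. \<Sum>j\<in>J. g j i)"
    by (simp add: g_def sum.cartesian_product)
  also have "\<dots> = (\<Sum>(j,i)\<in>J\<times>I. g j i)"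
    by (subst sum.swap) (simp add: sum.cartesian_product)
  also have "\<dots> = (\<Sum>(j,i)\<in>J\<times>I. \<Sum>(k,l)\<in>K\<times>L. f i j k l)"
    by (simp add: g_def)
  also have "\<dots> = (\<Sum>(k,l)\<in>K\<times>L. \<Sum>(j,i)\<in>J\<times>I. f i j k l)"
    using sum.swap[of "\<lambda>p q. f (snd p) (fst p) (fst q) (snd q)" "K\<times>L" "J\<times>I"]
    by (simp add: case_prod_unfold)
  also have "\<dots> = (\<Sum>k\<in>K. \<Sum>l\<in>L. \<Sum>j\<in>J. \<Sum>i\<in>I. f i j k l)"
    by (subst (2) sum.cartesian_product [symmetric]) (simp add: sum.cartesian_product [symmetric])
  finally show ?thesis .
qed

text \<open>Vectors and covectors are separate variables, so moving derivatives past multiplications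
  creates no commutator terms and both sides are the same fourfold sum.\<close>

lemma sum_pairing_polar:
  assumes "finite I"
  shows "(\<Sum>i\<in>I. \<Sum>j\<in>I. pairing i j * polar i j P) = (\<Sum>k\<in>UNIV. \<Sum>l\<in>UNIV. Xop I k l (Yop I k l P))"
proof -
  have "(\<Sum>k\<in>UNIV. \<Sum>l\<in>UNIV. Xop I k l (Yop I k l P)) = (\<Sum>k\<in>UNIV. \<Sum>l\<in>UNIV. \<Sum>j\<in>I. \<Sum>i\<in>I.
      var (Cov k i) * var (Vec k j) * pd (Cov l i) (pd (Vec l j) P))"
    by (simp add: Xop_def Yop_def pd_sum pd_var_mult sum_distrib_left pd_commute[of "Cov _ _"] mult_ac)
  also have "\<dots> = (\<Sum>i\<in>I. \<Sum>j\<in>I. \<Sum>k\<in>UNIV. \<Sum>l\<in>UNIV.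
      var (Cov k i) * var (Vec k j) * pd (Cov l i) (pd (Vec l j) P))"
    by (rule sum_swap4[symmetric])
  finally show ?thesis by (simp add: pairing_def polar_def sum_product)
qed

text \<open>The commutator is one second-order derivative. \<open>Yop I l k\<close> has the same
  commutator with \<open>polar i j\<close>, so \<open>polar i j\<close> commutes with the difference
  of the two and preserves invariance.\<close>

lemma polar_Xop:
  assumes "finite I" "j \<in> I"
  shows "polar i j (Xop I k l P) = Xop I k l (polar i j P) + pd (Cov k i) (pd (Vec l j) P)"
proof -
  have "polar i j (Xop I k l P) = (\<Sum>m\<in>UNIV. \<Sum>j'\<in>I. var (Vec k j') * pd (Cov m i) (pd (Vec m j) (pd (Vec l j') P))
      + (if m = k \<and> j = j' then pd (Cov m i) (pd (Vec l j') P) else 0))"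
    by (auto simp: polar_def Xop_def pd_sum pd_var_mult pd_add intro!: sum.cong)
  also have "\<dots> = Xop I k l (polar i j P) + (\<Sum>m\<in>UNIV. \<Sum>j'\<in>I.
      (if m = k \<and> j = j' then pd (Cov m i) (pd (Vec l j') P) else 0))"
    by (simp add: sum.distrib Xop_def polar_def pd_sum sum_distrib_left sum.swap[of _ UNIV I]
       pd_commute[of "Vec l _"])
  also have "(\<Sum>m\<in>UNIV. \<Sum>j'\<in>I. (if m = k \<and> j = j' then pd (Cov m i) (pd (Vec l j') P) else 0))
      = (\<Sum>m\<in>UNIV. if m = k then (\<Sum>j'\<in>I. if j = j' then pd (Cov m i) (pd (Vec l j') P) else 0) else 0)"
    by (intro sum.cong refl) auto
  also have "\<dots> = pd (Cov k i) (pd (Vec l j) P)"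
    using assms by simp
  finally show ?thesis .
qed

lemma polar_Yop:
  assumes "finite I" "i \<in> I"
  shows "polar i j (Yop I l k P) = Yop I l k (polar i j P) + pd (Cov k i) (pd (Vec l j) P)"
proof -
  have "polar i j (Yop I l k P) = (\<Sum>m\<in>UNIV. \<Sum>i'\<in>I. var (Cov l i') * pd (Cov m i) (pd (Vec m j) (pd (Cov k i') P))
      + (if m = l \<and> i = i' then pd (Vec m j) (pd (Cov k i') P) else 0))"
    by (auto simp: polar_def Yop_def pd_sum pd_var_mult pd_add intro!: sum.cong)
  also have "\<dots> = Yop I l k (polar i j P) + (\<Sum>m\<in>UNIV. \<Sum>i'\<in>I.
      (if m = l \<and> i = i' then pd (Vec m j) (pd (Cov k i') P) else 0))"
    by (simp add: sum.distrib Yop_def polar_def pd_sum sum_distrib_left sum.swap[of _ UNIV I]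
       pd_commute[of "Cov k _"])
  also have "(\<Sum>m\<in>UNIV. \<Sum>i'\<in>I. (if m = l \<and> i = i' then pd (Vec m j) (pd (Cov k i') P) else 0))
      = (\<Sum>m\<in>UNIV. if m = l then (\<Sum>i'\<in>I. if i = i' then pd (Vec m j) (pd (Cov k i') P) else 0) else 0)"
    by (intro sum.cong refl) auto
  also have "\<dots> = pd (Cov k i) (pd (Vec l j) P)"
    using assms by (simp add: pd_commute)
  finally show ?thesis .
qed

inductive_set pairing_monomials :: "nat set \<Rightarrow> ('k::finite) hvar mpoly set" for I where
  one: "1 \<in> pairing_monomials I"
| mult: "Q \<in> pairing_monomials I \<Longrightarrow> i \<in> I \<Longrightarrow> j \<in> I \<Longrightarrow> pairing i j * Q \<in> pairing_monomials I"

text \<open>\<open>Xop I k k\<close> multiplies each monomial by its total degree in the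
  \<open>k\<close>-th vector coordinates, a sum of nonnegative terms.\<close>

lemma Xop_diag_zero:
  assumes "finite I" "Xop I k k P = 0" "m \<in> keys P" "j \<in> I"
  shows "lookup m (Vec k j) = 0"
proof -
  have "lookup (Xop I k k P) m = real (\<Sum>j\<in>I. lookup m (Vec k j)) * lookup P m"
    by (simp add: Xop_def lookup_sum var_mult_pd_lookup sum_distrib_right)
  then have "(\<Sum>j\<in>I. lookup m (Vec k j)) = 0"
    using assms(2,3) by (simp add: in_keys_iff del: of_nat_sum)
  then show ?thesis using assms by simp
qed

lemma Yop_diag_zero:
  assumes "finite I" "Yop I k k P = 0" "m \<in> keys P" "j \<in> I"
  shows "lookup m (Cov k j) = 0"
proof -
  have "lookup (Yop I k k P) m = real (\<Sum>j\<in>I. lookup m (Cov k j)) * lookup P m"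
    by (simp add: Yop_def lookup_sum var_mult_pd_lookup sum_distrib_right)
  then have "(\<Sum>j\<in>I. lookup m (Cov k j)) = 0"
    using assms(2,3) by (simp add: in_keys_iff del: of_nat_sum)
  then show ?thesis using assms by simp
qed

lemma keys_subset_pd:
  assumes "\<And>m. m \<in> keys P \<Longrightarrow> keys m \<subseteq> V" "m \<in> keys (pd v P)"
  shows "keys m \<subseteq> V"
proof -
  have "m + single v 1 \<in> keys P" using assms(2) keys_pd[of v P] by auto
  then have "keys (m + single v 1) \<subseteq> V" by (rule assms(1))
  then show ?thesis by (auto simp: in_keys_iff lookup_add subset_iff)
qed

lemma mdeg_pd:
  assumes "\<And>m. m \<in> keys P \<Longrightarrow> mdeg m \<le> N" "m \<in> keys (pd v P)"
  shows "mdeg m + 1 \<le> N"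
proof -
  have "m + single v 1 \<in> keys P" using assms(2) keys_pd[of v P] by auto
  from assms(1)[OF this] show ?thesis by simp
qed

text \<open>Invariance replaces \<open>Yop I k l P\<close> by \<open>Xop I l k P\<close>, and
  \<open>Xop I k l\<close> is adjoint to \<open>Xop I l k\<close>. The vanishing left side thus
  becomes a sum of squared norms, and its diagonal terms exclude every variable.\<close>

lemma harmonic_invariant_const:
  fixes P :: "('k::finite) hvar mpoly"
  assumes I: "finite I"
    and vars: "\<And>m. m \<in> keys P \<Longrightarrow> keys m \<subseteq> hvars I"
    and inv: "\<And>k l. Xop I k l P = Yop I l k P"
    and harm: "\<And>i j. i \<in> I \<Longrightarrow> j \<in> I \<Longrightarrow> polar i j P = 0"
  shows "keys P \<subseteq> {0}"
proof -
  have "0 = fischer P (\<Sum>i\<in>I. \<Sum>j\<in>I. pairing i j * polar i j P)"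
    using harm by simp
  also have "\<dots> = (\<Sum>k\<in>UNIV. \<Sum>l\<in>UNIV. fischer P (Xop I k l (Xop I l k P)))"
    unfolding sum_pairing_polar[OF I] by (simp add: fischer_sum_right inv)
  also have "\<dots> = (\<Sum>k\<in>UNIV. \<Sum>l\<in>UNIV. fischer (Xop I l k P) (Xop I l k P))"
    by (simp add: fischer_Xop)
  finally have "\<forall>k\<in>UNIV. (\<Sum>l\<in>UNIV. fischer (Xop I l k P) (Xop I l k P)) = 0"
    by (subst (asm) eq_commute, subst (asm) sum_nonneg_eq_0_iff) (auto intro!: sum_nonneg fischer_nonneg)
  then have "fischer (Xop I l k P) (Xop I l k P) = 0" for k l
    by (subst (asm) sum_nonneg_eq_0_iff) (auto intro!: fischer_nonneg)
  then have X: "Xop I k k P = 0" for k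
    using fischer_eq_0 by blast
  then have Y: "Yop I k k P = 0" for k
    using inv by metis
  have "m = 0" if "m \<in> keys P" for m
  proof (rule poly_mapping_eqI)
    fix v :: "'k hvar"
    show "lookup m v = lookup 0 v"
      using Xop_diag_zero[OF I X that] Yop_diag_zero[OF I Y that] vars[OF that]
      by (cases "v \<in> keys m") (force simp: hvars_def, simp add: in_keys_iff)
  qed
  then show ?thesis by blast
qed

text \<open>Induction on a degree bound. As the adjoint of multiplication by
  \<open>pairing i j\<close>, \<open>polar i j\<close> inherits orthogonality to the pairing
  monomials, so it sends \<open>P\<close> to a polynomial of the same kind and lower degree, which
  is zero. The constant that remains is orthogonal to \<open>1\<close>.\<close>

lemma invariant_orthogonal_pairings:
  fixes P :: "('k::finite) hvar mpoly"
  assumes I: "finite I"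
    and vars: "\<And>m. m \<in> keys P \<Longrightarrow> keys m \<subseteq> hvars I"
    and inv: "\<And>k l. Xop I k l P = Yop I l k P"
    and orth: "\<And>Q. Q \<in> pairing_monomials I \<Longrightarrow> fischer P Q = 0"
  shows "P = 0"
proof -
  have "P = 0" if "\<And>m. m \<in> keys P \<Longrightarrow> mdeg m \<le> N" for N
    using that vars inv orth
  proof (induction N arbitrary: P rule: less_induct)
    case (less N)
    have "polar i j P = 0" if ij: "i \<in> I" "j \<in> I" for i j
    proof (cases "N = 0")
      case True
      have "pd v P = 0" for v
      proof -
        have "mdeg m + 1 \<le> N" if "m \<in> keys (pd v P)" for m
          using mdeg_pd[of P N m v] less.prems(1) that by blast
        then have "keys (pd v P) = {}" using True by (intro equals0I) auto
        then show ?thesis by simp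
      qed
      then show ?thesis by (simp add: polar_def)
    next
      case False
      show ?thesis
      proof (rule less.IH[of "N - 1"])
        show "N - 1 < N" using False by simp
      next
        fix m assume "m \<in> keys (polar i j P)"
        then obtain k where k: "m \<in> keys (pd (Cov k i) (pd (Vec k j) P))"
          unfolding polar_def using keys_sum_subset_UN[of "\<lambda>k. pd (Cov k i) (pd (Vec k j) P)" UNIV] by auto
        show "keys m \<subseteq> hvars I"
          by (rule keys_subset_pd[OF keys_subset_pd[OF less.prems(2)] k])
        \<comment> \<open>\<open>polar\<close> lowers the degree by two; a drop by one already gives
          the induction measure.\<close>
        have "mdeg m + 1 \<le> N"
          by (rule mdeg_pd[OF _ k]) (use mdeg_pd[OF less.prems(1)] in fastforce)
        then show "mdeg m \<le> N - 1" by simp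
      next
        fix k l
        show "Xop I k l (polar i j P) = Yop I l k (polar i j P)"
          using polar_Xop[OF I ij(2), of i k l P] polar_Yop[OF I ij(1), of j l k P] less.prems(3)[of k l]
          by simp
      next
        fix Q :: "'k hvar mpoly" assume "Q \<in> pairing_monomials I"
        then have "fischer P (pairing i j * Q) = 0"
          by (intro less.prems(4) pairing_monomials.mult ij)
        then show "fischer (polar i j P) Q = 0"
          by (metis fischer_pairing fischer_sym)
      qed
    qed
    then have "keys P \<subseteq> {0}"
      using less.prems(2,3) by (intro harmonic_invariant_const[OF I]) blast+
    moreover have "lookup P 0 = 0"
      using less.prems(4)[OF pairing_monomials.one]
      by (simp add: fischer_sym[of P] fischer_single mfact_def flip: single_one)
    ultimately show ?case by (metis in_keys_iff keys_eq_empty subset_singletonD singletonI)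
  qed
  moreover have "mdeg m \<le> Max (mdeg ` keys P)" if "m \<in> keys P" for m using that by simp
  ultimately show ?thesis by blast
qed


section \<open>Weights under rescaling a vector and its covector by inverse factors\<close>

definition wt :: "nat \<Rightarrow> (('k::finite) hvar \<Rightarrow>\<^sub>0 nat) \<Rightarrow> int" where
  "wt i m = (\<Sum>k\<in>UNIV. int (lookup m (Vec k i)) - int (lookup m (Cov k i)))"

lemma wt_add [simp]: "wt i (m + m') = wt i m + wt i m'"
  by (simp add: wt_def lookup_add sum.distrib algebra_simps sum_subtractf)

lemma wt_0 [simp]: "wt i 0 = 0"
  by (simp add: wt_def)

lemma wt_sum: "wt i (sum f A) = (\<Sum>a\<in>A. wt i (f a))"
  by (induction A rule: infinite_finite_induct) auto

lemma wt_single_Vec [simp]: "wt i (single (Vec k j) c) = (if i = j then int c else 0)"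
  by (auto simp: wt_def lookup_single when_def if_distrib[of int] cong: if_cong)

lemma wt_single_Cov [simp]: "wt i (single (Cov k j) c) = (if i = j then - int c else 0)"
  by (auto simp: wt_def lookup_single when_def if_distrib[of int] if_distrib[of uminus] cong: if_cong)

text \<open>Homogeneity for the rescalings of the single points, with one common weight, and not for
  the total degree.\<close>

definition homogeneous :: "nat set \<Rightarrow> int \<Rightarrow> ('k::finite) hvar mpoly \<Rightarrow> bool" where
  "homogeneous I N Q \<longleftrightarrow> (\<forall>m\<in>keys Q. keys m \<subseteq> hvars I \<and> (\<forall>i\<in>I. wt i m = N))"

lemma finite_hvars [simp]: "finite I \<Longrightarrow> finite (hvars I :: ('k::finite) hvar set)"
  by (simp add: hvars_def)

lemma Vec_in_hvars [simp]: "Vec k i \<in> hvars I \<longleftrightarrow> i \<in> I" 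
  and Cov_in_hvars [simp]: "Cov k i \<in> hvars I \<longleftrightarrow> i \<in> I"
  by (auto simp: hvars_def)

definition rescale :: "(nat \<Rightarrow> real) \<Rightarrow> ('k hvar \<Rightarrow> real) \<Rightarrow> 'k hvar \<Rightarrow> real" where
  "rescale c z v = (case v of Vec k i \<Rightarrow> c i * z v | Cov k i \<Rightarrow> z v / c i)"

lemma meval_rescale:
  fixes m :: "('k::finite) hvar \<Rightarrow>\<^sub>0 nat"
  assumes "finite I" and c: "\<And>i. i \<in> I \<Longrightarrow> c i \<noteq> 0" and "keys m \<subseteq> hvars I"
  shows "meval (rescale c z) m = (\<Prod>i\<in>I. c i powi wt i m) * meval z m"
  using assms(3)
proof (induction m rule: monom_induct)
  case (add m v)
  show ?case
  proof (cases v)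
    case (Vec k j)
    then have "(\<Prod>i\<in>I. c i powi wt i (single v 1 + m)) = (\<Prod>i\<in>I. (if i = j then c j else 1) * c i powi wt i m)"
      by (intro prod.cong) (auto simp: power_int_add c)
    also have "\<dots> = c j * (\<Prod>i\<in>I. c i powi wt i m)"
      using add.hyps Vec \<open>finite I\<close> by (simp add: prod.distrib)
    finally show ?thesis using Vec add.IH by (simp add: meval_add rescale_def)
  next
    case (Cov k j)
    then have "(\<Prod>i\<in>I. c i powi wt i (single v 1 + m)) = (\<Prod>i\<in>I. (if i = j then inverse (c j) else 1) * c i powi wt i m)"
      by (intro prod.cong) (auto simp: power_int_add c power_int_minus)
    also have "\<dots> = inverse (c j) * (\<Prod>i\<in>I. c i powi wt i m)"
      using add.hyps Cov \<open>finite I\<close> by (simp add: prod.distrib)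
    finally show ?thesis using Cov add.IH by (simp add: meval_add rescale_def field_simps)
  qed
qed simp

lemma eval_rescale:
  fixes Q :: "('k::finite) hvar mpoly"
  assumes "finite I" "\<And>i. i \<in> I \<Longrightarrow> c i \<noteq> 0" "homogeneous I N Q"
  shows "eval (rescale c z) Q = (\<Prod>i\<in>I. c i powi N) * eval z Q"
proof -
  have "eval (rescale c z) Q = (\<Sum>m\<in>keys Q. lookup Q m * ((\<Prod>i\<in>I. c i powi wt i m) * meval z m))"
    unfolding eval_def using assms by (intro sum.cong) (auto simp: meval_rescale homogeneous_def)
  also have "\<dots> = (\<Sum>m\<in>keys Q. (\<Prod>i\<in>I. c i powi N) * (lookup Q m * meval z m))"
    using assms(3) by (intro sum.cong) (auto simp: homogeneous_def)
  finally show ?thesis by (simp add: eval_def sum_distrib_left)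
qed


subsection \<open>Normal forms modulo the incidence relations\<close>

definition incident :: "nat set \<Rightarrow> (3 hvar \<Rightarrow> real) \<Rightarrow> bool" where
  "incident I z \<longleftrightarrow> (\<forall>i\<in>I. (\<Sum>k\<in>UNIV. z (Cov k i) * z (Vec k i)) = 0)"

text \<open>Coordinate 2 is singled out because the denominators to be compared later involve only
  coordinates 1 and 3; multiplying by them keeps a monomial normal.\<close>

definition normal :: "nat set \<Rightarrow> (3 hvar \<Rightarrow>\<^sub>0 nat) \<Rightarrow> bool" where
  "normal I m \<longleftrightarrow> (\<forall>i\<in>I. lookup m (Vec 2 i) = 0 \<or> lookup m (Cov 2 i) = 0)"

text \<open>The incidence relation trades a product of second coordinates for products of first and
  of third ones. All three products have weight zero, and the degree in the second vector
  coordinates drops.\<close>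

lemma monomial_normal_form:
  fixes m :: "3 hvar \<Rightarrow>\<^sub>0 nat"
  assumes I: "finite I" and "keys m \<subseteq> hvars I"
  shows "\<exists>Q. (\<forall>m'\<in>keys Q. keys m' \<subseteq> hvars I \<and> normal I m' \<and> (\<forall>i. wt i m' = wt i m)) \<and>
    (\<forall>z. incident I z \<longrightarrow> eval z Q = meval z m)"
  using assms(2)
proof (induction "\<Sum>i\<in>I. lookup m (Vec 2 i)" arbitrary: m rule: less_induct)
  case less
  show ?case
  proof (cases "normal I m")
    case True
    then show ?thesis using less.prems by (intro exI[of _ "single m 1"]) auto
  next
    case False
    then obtain i where i: "i \<in> I" "lookup m (Vec 2 i) \<noteq> 0" "lookup m (Cov 2 i) \<noteq> 0"
      by (auto simp: normal_def)
    define r where "r = m - single (Vec 2 i) 1 - single (Cov 2 i) 1"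
    have m: "m = single (Vec 2 i) 1 + single (Cov 2 i) 1 + r"
      unfolding r_def using i(2,3)
      by (intro poly_mapping_eqI) (auto simp: lookup_add lookup_minus lookup_single when_def)
    define f where "f k = single (Vec k i) 1 + single (Cov k i) 1 + r" for k
    have "keys r \<subseteq> hvars I" using less.prems
      by (auto simp: r_def in_keys_iff lookup_minus subset_iff)
    then have keys_f: "keys (f k) \<subseteq> hvars I" for k
      unfolding f_def using i(1) keys_add[of "single (Vec k i) 1 + single (Cov k i) 1" r]
        keys_add[of "single (Vec k i) 1" "single (Cov k i) (1::nat)"] by fastforce
    have sum_f: "(\<Sum>j\<in>I. lookup (f k) (Vec 2 j)) < (\<Sum>j\<in>I. lookup m (Vec 2 j))" if "k \<noteq> 2" for k
      by (rule sum_strict_mono_ex1[OF I])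
        (use that i(1) in \<open>auto simp: m f_def lookup_add lookup_single when_def intro!: bexI[of _ i]\<close>)
    have wt_f: "wt j (f k) = wt j m" for j k by (simp add: m f_def)
    obtain Q1 where Q1: "\<forall>m'\<in>keys Q1. keys m' \<subseteq> hvars I \<and> normal I m' \<and> (\<forall>i. wt i m' = wt i m)"
        "\<And>z. incident I z \<Longrightarrow> eval z Q1 = meval z (f 1)"
      using less.hyps[OF sum_f keys_f, of 1] unfolding wt_f by auto
    obtain Q3 where Q3: "\<forall>m'\<in>keys Q3. keys m' \<subseteq> hvars I \<and> normal I m' \<and> (\<forall>i. wt i m' = wt i m)"
        "\<And>z. incident I z \<Longrightarrow> eval z Q3 = meval z (f 3)"
      using less.hyps[OF sum_f keys_f, of 3] unfolding wt_f by auto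
    have "eval z (- Q1 - Q3) = meval z m" if "incident I z" for z
    proof -
      have "z (Cov 1 i) * z (Vec 1 i) + z (Cov 2 i) * z (Vec 2 i) + z (Cov 3 i) * z (Vec 3 i) = 0"
        using that i(1) by (simp add: incident_def sum_3)
      then have "z (Vec 2 i) * z (Cov 2 i) = - (z (Vec 1 i) * z (Cov 1 i)) - z (Vec 3 i) * z (Cov 3 i)"
        by (simp add: algebra_simps)
      then have "(z (Vec 2 i) * z (Cov 2 i)) * meval z r =
          (- (z (Vec 1 i) * z (Cov 1 i)) - z (Vec 3 i) * z (Cov 3 i)) * meval z r"
        by simp
      then show ?thesis using Q1(2)[OF that] Q3(2)[OF that]
        by (simp add: m f_def meval_add algebra_simps)
    qed
    moreover have "\<forall>m'\<in>keys (- Q1 - Q3). keys m' \<subseteq> hvars I \<and> normal I m' \<and> (\<forall>i. wt i m' = wt i m)"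
    proof
      fix m' assume "m' \<in> keys (- Q1 - Q3)"
      then have "m' \<in> keys Q1 \<union> keys Q3" by (auto simp: in_keys_iff lookup_minus)
      then show "keys m' \<subseteq> hvars I \<and> normal I m' \<and> (\<forall>i. wt i m' = wt i m)"
        using Q1(1) Q3(1) by blast
    qed
    ultimately show ?thesis by blast
  qed
qed

lemma normal_form:
  fixes Q :: "3 hvar mpoly"
  assumes I: "finite I" and "homogeneous I N Q"
  obtains Q' where "homogeneous I N Q'" "\<And>m. m \<in> keys Q' \<Longrightarrow> normal I m"
    "\<And>z. incident I z \<Longrightarrow> eval z Q' = eval z Q"
proof -
  let ?P = "\<lambda>Q Q'. homogeneous I N Q' \<and> (\<forall>m\<in>keys Q'. normal I m) \<and>
    (\<forall>z. incident I z \<longrightarrow> eval z Q' = eval z Q)"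
  have "keys Q \<subseteq> {m. keys m \<subseteq> hvars I \<and> (\<forall>i\<in>I. wt i m = N)}"
    using assms(2) by (auto simp: homogeneous_def)
  then have "\<exists>Q'. ?P Q Q'"
  proof (induction Q rule: mpoly_induct_keys)
    case (single m c)
    then obtain Q where Q: "\<forall>m'\<in>keys Q. keys m' \<subseteq> hvars I \<and> normal I m' \<and> (\<forall>i. wt i m' = wt i m)"
      "\<forall>z. incident I z \<longrightarrow> eval z Q = meval z m"
      using monomial_normal_form[OF I, of m] by blast
    have "keys (cst c * Q) \<subseteq> keys Q" by (rule keys_cst_mult)
    then have "?P (single m c) (cst c * Q)"
      using Q single by (auto simp: homogeneous_def)
    then show ?case by blast
  next
    case (add F G)
    then obtain F' G' where "?P F F'" "?P G G'" by blast
    then have "?P (F + G) (F' + G')"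
      using keys_add[of F' G'] by (auto simp: homogeneous_def)
    then show ?case by blast
  next
    show "\<exists>Q'. ?P 0 Q'" by (intro exI[of _ 0]) (simp add: homogeneous_def)
  qed
  then show ?thesis using that by blast
qed

text \<open>In a normal form the exponent of \<open>t\<close> after substituting \<open>(t, s / t)\<close> for the second coordinates
  determines both of their exponents, so the coefficients of this Laurent polynomial determine the value
  at every choice of the second coordinates.\<close>

lemma normal_vanish_step:
  fixes R :: "3 hvar mpoly"
  assumes I: "finite I" "k \<in> I"
    and R: "\<And>m. m \<in> keys R \<Longrightarrow> keys m \<subseteq> hvars I" "\<And>m. m \<in> keys R \<Longrightarrow> normal I m"
    and s: "s \<noteq> 0" 
    and van: "\<And>t. t \<noteq> 0 \<Longrightarrow> eval (z(Vec 2 k := t, Cov 2 k := s / t)) R = 0"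
  shows "eval z R = 0"
proof -
  define W where "W = hvars I - {Vec 2 k, Cov (2::3) k}"
  have W: "finite W" "Vec 2 k \<notin> W" "Cov 2 k \<notin> W" "hvars I = insert (Vec 2 k) (insert (Cov 2 k) W)"
    using I by (auto simp: W_def)
  define r where "r m = lookup R m * (\<Prod>v\<in>W. z v ^ lookup m v)" for m
  define a where "a m = lookup m (Vec 2 k)" for m :: "3 hvar \<Rightarrow>\<^sub>0 nat"
  define b where "b m = lookup m (Cov 2 k)" for m :: "3 hvar \<Rightarrow>\<^sub>0 nat"
  have ev: "eval (z(Vec 2 k := t, Cov 2 k := u)) R = (\<Sum>m\<in>keys R. r m * (t ^ a m * u ^ b m))" for t u
  proof -
    have "meval (z(Vec 2 k := t, Cov 2 k := u)) m = t ^ a m * u ^ b m * (\<Prod>v\<in>W. z v ^ lookup m v)"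
      if "m \<in> keys R" for m
    proof -
      have "(\<Prod>v\<in>W. (z(Vec 2 k := t, Cov 2 k := u)) v ^ lookup m v) = (\<Prod>v\<in>W. z v ^ lookup m v)"
        using W by (intro prod.cong) auto
      then show ?thesis
        using R(1)[OF that] W(1-3)
        by (subst meval_superset[of "hvars I"]) (auto simp: W(4) a_def b_def I)
    qed
    then show ?thesis by (simp add: eval_def r_def mult_ac cong: sum.cong)
  qed
  \<comment> \<open>Multiplying by \<open>t ^ M\<close> clears the negative powers of
    \<open>t\<close>; since \<open>b m \<le> M\<close>, the subtraction in \<open>e\<close> is
    exact.\<close>
  define M where "M = Max (b ` keys R)"
  have M: "b m \<le> M" if "m \<in> keys R" for m using that by (simp add: M_def)
  define e where "e m = M + a m - b m" for m
  define p where "p = (\<Sum>m\<in>keys R. monom (r m * s ^ b m) (e m))"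
  have "poly p t = 0" if "t \<noteq> 0" for t
  proof -
    have "poly p t = t ^ M * (\<Sum>m\<in>keys R. r m * (t ^ a m * (s / t) ^ b m))"
      unfolding p_def poly_sum poly_monom sum_distrib_left
    proof (intro sum.cong refl)
      fix m assume m: "m \<in> keys R"
      have "t ^ e m = t ^ M * t ^ a m / t ^ b m"
        unfolding e_def using that M[OF m] by (simp add: power_diff power_add)
      then show "r m * s ^ b m * t ^ e m = t ^ M * (r m * (t ^ a m * (s / t) ^ b m))"
        by (simp add: power_divide)
    qed
    then show ?thesis using van[OF that] by (simp add: ev)
  qed
  then have "infinite {t. poly p t = 0}"
    using infinite_super[of "- {0::real}" "{t. poly p t = 0}"] by (auto simp: Compl_eq_Diff_UNIV infinite_UNIV_char_0)
  then have "p = 0" using poly_roots_finite by blast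
  have group: "(\<Sum>m\<in>{m\<in>keys R. e m = j}. r m) = 0" for j
  proof -
    \<comment> \<open>By normality one of \<open>a m\<close> and \<open>b m\<close> is zero, so
      truncated subtraction recovers both from the one exponent \<open>j\<close>.\<close>
    have ab: "a m = j - M" "b m = M - j" if "m \<in> keys R" "e m = j" for m
      using R(2)[OF that(1)] that(2) I(2) M[OF that(1)] unfolding normal_def e_def a_def b_def by force+
    have "0 = coeff p j" using \<open>p = 0\<close> by simp
    also have "\<dots> = (\<Sum>m\<in>keys R. if e m = j then r m * s ^ b m else 0)"
      by (simp add: p_def coeff_sum)
    also have "\<dots> = (\<Sum>m\<in>{m\<in>keys R. e m = j}. r m * s ^ b m)"
      by (simp add: sum.inter_filter)
    also have "\<dots> = (\<Sum>m\<in>{m\<in>keys R. e m = j}. r m) * s ^ (M - j)"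
      unfolding sum_distrib_right using ab by (intro sum.cong) auto
    finally show ?thesis using s by simp
  qed
  have ab: "a m = e m - M" "b m = M - e m" if "m \<in> keys R" for m
    using R(2)[OF that] I(2) M[OF that] unfolding normal_def e_def a_def b_def by force+
  have "eval z R = (\<Sum>m\<in>keys R. r m * (z (Vec 2 k) ^ (e m - M) * z (Cov 2 k) ^ (M - e m)))"
    using ev[of "z (Vec 2 k)" "z (Cov 2 k)"] by (simp add: ab cong: sum.cong)
  also have "\<dots> = (\<Sum>j\<in>e ` keys R. \<Sum>m\<in>{m\<in>keys R. e m = j}. r m * (z (Vec 2 k) ^ (e m - M) * z (Cov 2 k) ^ (M - e m)))"
    by (rule sum.image_gen) simp
  also have "\<dots> = (\<Sum>j\<in>e ` keys R. (\<Sum>m\<in>{m\<in>keys R. e m = j}. r m) * (z (Vec 2 k) ^ (j - M) * z (Cov 2 k) ^ (M - j)))"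
    unfolding sum_distrib_right by (intro sum.cong refl) auto
  also have "\<dots> = 0" by (simp add: group)
  finally show ?thesis .
qed

text \<open>Incidence is dropped at one point after another, as long as all first vector coordinates
  are nonzero; a monomial factor then removes this last restriction.\<close>

lemma normal_form_unique:
  fixes R :: "3 hvar mpoly"
  assumes I: "finite I"
    and R: "\<And>m. m \<in> keys R \<Longrightarrow> keys m \<subseteq> hvars I" "\<And>m. m \<in> keys R \<Longrightarrow> normal I m"
    and van: "\<And>z. incident I z \<Longrightarrow> eval z R = 0"
  shows "R = 0"
proof -
  \<comment> \<open>\<open>J\<close> collects the points at which incidence is no longer
    required.\<close>
  have main: "eval z R = 0" if "J \<subseteq> I" "incident (I - J) z" "\<forall>i\<in>I. z (Vec 1 i) \<noteq> 0" for J z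
  proof -
    have "finite J" using that(1) I finite_subset by blast
    then show ?thesis using that
    proof (induction J arbitrary: z rule: finite_induct)
      case empty
      then show ?case using van by simp
    next
      case (insert k J)
      have k: "k \<in> I" using insert.prems by simp
      \<comment> \<open>The value that incidence at \<open>k\<close> prescribes for the product of
        the two second coordinates.\<close>
      define s where "s z = - (z (Vec 1 k) * z (Cov 1 k)) - z (Vec 3 k) * z (Cov (3::3) k)" for z :: "3 hvar \<Rightarrow> real"
      have generic: "eval w R = 0" if w: "s w \<noteq> 0" "incident (I - insert k J) w" "\<forall>i\<in>I. w (Vec 1 i) \<noteq> 0" for w
      proof (rule normal_vanish_step[OF I k R w(1)])
        fix t :: real assume t: "t \<noteq> 0"
        let ?w = "w(Vec 2 k := t, Cov 2 k := s w / t)"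
        show "eval ?w R = 0"
        proof (rule insert.IH)
          show "J \<subseteq> I" using insert.prems by simp
          show "\<forall>i\<in>I. ?w (Vec 1 i) \<noteq> 0" using w by simp
          have "(\<Sum>l\<in>UNIV. ?w (Cov l k) * ?w (Vec l k)) = 0"
            using t by (simp add: sum_3 s_def)
          moreover have "(\<Sum>l\<in>UNIV. ?w (Cov l i) * ?w (Vec l i)) = 0" if "i \<in> I - J" "i \<noteq> k" for i
            using w(2) that by (simp add: incident_def)
          ultimately show "incident (I - J) ?w"
            unfolding incident_def by blast
        qed
      qed
      show ?case
      proof (cases "s z = 0")
        case False
        then show ?thesis using generic insert.prems by simp
      next
        case True
        \<comment> \<open>Shifting the first covector coordinate moves \<open>s\<close> away from
          zero because \<open>z (Vec 1 k)\<close> is nonzero; continuity then covers the exceptional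
          case.\<close>
        define \<phi> where "\<phi> v e = (if v = Cov 1 k then z v + e else z v)" for v and e :: real
        have "((\<lambda>e. eval (\<lambda>v. \<phi> v e) R) has_real_derivative
          (\<Sum>v\<in>hvars I. (if v = Cov 1 k then 1 else 0) * eval (\<lambda>v. \<phi> v 0) (pd v R))) (at 0)"
          by (rule eval_has_derivative) (auto simp: I R \<phi>_def intro!: derivative_eq_intros)
        then have "isCont (\<lambda>e. eval (\<lambda>v. \<phi> v e) R) 0"
          by (rule DERIV_isCont)
        then have "(\<lambda>e. eval (\<lambda>v. \<phi> v e) R) \<midarrow>0\<rightarrow> eval (\<lambda>v. \<phi> v 0) R"
          by (simp add: isCont_def)
        moreover have "eval (\<lambda>v. \<phi> v e) R = 0" if "e \<noteq> 0" for e
        proof (rule generic)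
          have "s (\<lambda>v. \<phi> v e) = s z - z (Vec 1 k) * e"
            by (simp add: s_def \<phi>_def algebra_simps)
          then show "s (\<lambda>v. \<phi> v e) \<noteq> 0" using True that insert.prems(3) k by simp
          show "incident (I - insert k J) (\<lambda>v. \<phi> v e)"
            using insert.prems(2) by (auto simp: incident_def \<phi>_def)
          show "\<forall>i\<in>I. \<phi> (Vec 1 i) e \<noteq> 0" using insert.prems(3) by (simp add: \<phi>_def)
        qed
        then have "(\<lambda>e. eval (\<lambda>v. \<phi> v e) R) \<midarrow>0\<rightarrow> 0"
          by (intro tendsto_eventually) (auto simp: eventually_at_filter)
        ultimately have "eval (\<lambda>v. \<phi> v 0) R = 0" by (rule LIM_unique)
        moreover have "(\<lambda>v. \<phi> v 0) = z" by (auto simp: \<phi>_def)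
        ultimately show ?thesis by simp
      qed
    qed
  qed
  \<comment> \<open>The product of all first vector coordinates vanishes exactly where
    \<open>main\<close> does not apply.\<close>
  define m where "m = (\<Sum>i\<in>I. single (Vec (1::3) i) (1::nat))"
  have "eval z (single m 1 * R) = 0" for z
  proof (cases "\<forall>i\<in>I. z (Vec 1 i) \<noteq> 0")
    case True
    then show ?thesis using main[of I z] by (simp add: incident_def)
  next
    case False
    then show ?thesis using I by (auto simp: m_def meval_sum)
  qed
  then have "single m 1 * R = 0" by (rule eval_zero_imp_zero)
  then show ?thesis by (simp add: single_mult_eq_0_iff)
qed


section \<open>Lifting invariants to homogeneous coordinates\<close>

definition chart :: "(jet_var \<Rightarrow> real) \<Rightarrow> 3 hvar \<Rightarrow> real" where
  "chart z v = (case v of Vec k i \<Rightarrow> pt z i $ k | Cov k i \<Rightarrow> covec z i $ k)"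

lemma chart_simps [simp]:
  "chart z (Vec 1 i) = z (Xv i)" "chart z (Vec 2 i) = z (Yv i)" "chart z (Vec 3 i) = 1"
  "chart z (Cov 1 i) = z (Pv i)" "chart z (Cov 2 i) = z (Qv i)"
  "chart z (Cov 3 i) = - z (Pv i) * z (Xv i) - z (Qv i) * z (Yv i)"
  by (simp_all add: chart_def pt_def covec_def)

lemma incident_chart: "incident I (chart z)"
  by (simp add: incident_def sum_3 algebra_simps)

text \<open>With indices \<open>1 2 3\<close> this is homogenization to degree \<open>N\<close>; with \<open>3 2 1\<close> it is homogenization
  followed by the swap of coordinates 1 and 3. The truncated exponent is exact once \<open>N \<ge> mdeg m\<close>.\<close>

definition hmonom :: "3 \<Rightarrow> 3 \<Rightarrow> 3 \<Rightarrow> nat set \<Rightarrow> nat \<Rightarrow> (jet_var \<Rightarrow>\<^sub>0 nat) \<Rightarrow> (3 hvar \<Rightarrow>\<^sub>0 nat)" where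
  "hmonom a b c I N m = (\<Sum>i\<in>I. single (Vec a i) (lookup m (Xv i)) + single (Vec b i) (lookup m (Yv i))
     + single (Cov a i) (lookup m (Pv i)) + single (Cov b i) (lookup m (Qv i))
     + single (Vec c i) (N + lookup m (Pv i) + lookup m (Qv i) - lookup m (Xv i) - lookup m (Yv i)))"

lemma lookup_add_le_mdeg:
  assumes "u \<noteq> v"
  shows "lookup m u + lookup m v \<le> mdeg m"
proof -
  have "mdeg m = (\<Sum>w\<in>insert u (insert v (keys m)). lookup m w)"
    by (rule mdeg_superset) auto
  also have "\<dots> \<ge> (\<Sum>w\<in>{u, v}. lookup m w)"
    by (rule sum_mono2) auto
  finally show ?thesis using assms by simp
qed

lemma wt_hmonom:
  assumes "finite I" "i \<in> I" "mdeg m \<le> N"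
  shows "wt i (hmonom a b c I N m) = int N"
proof -
  have "lookup m (Xv i) + lookup m (Yv i) \<le> N"
    using lookup_add_le_mdeg[of "Xv i" "Yv i" m] assms by simp
  then show ?thesis
    using assms by (simp add: hmonom_def wt_sum sum.distrib of_nat_diff algebra_simps cong: if_cong)
qed

lemma keys_hmonom: "keys (hmonom a b c I N m) \<subseteq> hvars I"
proof
  fix v assume "v \<in> keys (hmonom a b c I N m)"
  then have "(\<Sum>i\<in>I. lookup (single (Vec a i) (lookup m (Xv i)) + single (Vec b i) (lookup m (Yv i))
     + single (Cov a i) (lookup m (Pv i)) + single (Cov b i) (lookup m (Qv i))
     + single (Vec c i) (N + lookup m (Pv i) + lookup m (Qv i) - lookup m (Xv i) - lookup m (Yv i))) v) \<noteq> 0"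
    by (simp add: hmonom_def in_keys_iff lookup_sum)
  then obtain i where i: "i \<in> I" and "lookup (single (Vec a i) (lookup m (Xv i)) + single (Vec b i) (lookup m (Yv i))
     + single (Cov a i) (lookup m (Pv i)) + single (Cov b i) (lookup m (Qv i))
     + single (Vec c i) (N + lookup m (Pv i) + lookup m (Qv i) - lookup m (Xv i) - lookup m (Yv i))) v \<noteq> 0"
    by (rule sum.not_neutral_contains_not_neutral)
  then have "v = Vec a i \<or> v = Vec b i \<or> v = Cov a i \<or> v = Cov b i \<or> v = Vec c i"
    by (auto simp: lookup_add lookup_single when_def split: if_splits)
  with i show "v \<in> hvars I" by auto
qed

lemma finite_jet_vars: "finite (jet_vars n)"
  by (simp add: jet_vars_def)

lemma meval_jet:
  assumes "keys m \<subseteq> jet_vars n"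
  shows "meval z m = (\<Prod>i\<in>{1..n}. z (Xv i) ^ lookup m (Xv i) * z (Yv i) ^ lookup m (Yv i) *
    z (Pv i) ^ lookup m (Pv i) * z (Qv i) ^ lookup m (Qv i))"
proof -
  have "meval z m = (\<Prod>v\<in>jet_vars n. z v ^ lookup m v)"
    using assms by (rule meval_superset[OF finite_jet_vars])
  also have "\<dots> = (\<Prod>i\<in>{1..n}. \<Prod>v\<in>{Xv i, Yv i, Pv i, Qv i}. z v ^ lookup m v)"
    unfolding jet_vars_def by (rule prod.UNION_disjoint) auto
  also have "\<dots> = (\<Prod>i\<in>{1..n}. z (Xv i) ^ lookup m (Xv i) * z (Yv i) ^ lookup m (Yv i) *
    z (Pv i) ^ lookup m (Pv i) * z (Qv i) ^ lookup m (Qv i))"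
    by (simp add: mult.assoc)
  finally show ?thesis .
qed

lemma meval_hmonom:
  "meval \<phi> (hmonom a b c I N m) = (\<Prod>i\<in>I. \<phi> (Vec a i) ^ lookup m (Xv i) * \<phi> (Vec b i) ^ lookup m (Yv i) *
    \<phi> (Cov a i) ^ lookup m (Pv i) * \<phi> (Cov b i) ^ lookup m (Qv i) *
    \<phi> (Vec c i) ^ (N + lookup m (Pv i) + lookup m (Qv i) - lookup m (Xv i) - lookup m (Yv i)))"
  by (simp add: hmonom_def meval_sum meval_add)

definition hpoly :: "3 \<Rightarrow> 3 \<Rightarrow> 3 \<Rightarrow> nat set \<Rightarrow> nat \<Rightarrow> jet_poly \<Rightarrow> 3 hvar mpoly" where
  "hpoly a b c I N F = (\<Sum>m\<in>keys F. single (hmonom a b c I N m) (lookup F m))"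

lemma homogeneous_hpoly:
  assumes "finite I" "\<And>m. m \<in> keys F \<Longrightarrow> mdeg m \<le> N"
  shows "homogeneous I (int N) (hpoly a b c I N F)"
  unfolding homogeneous_def
proof
  fix m assume "m \<in> keys (hpoly a b c I N F)"
  then obtain m' where "m' \<in> keys F" "m = hmonom a b c I N m'"
    unfolding hpoly_def using keys_sum_subset_UN[of "\<lambda>m. single (hmonom a b c I N m) (lookup F m)" "keys F"]
    by (auto split: if_splits)
  then show "keys m \<subseteq> hvars I \<and> (\<forall>i\<in>I. wt i m = int N)"
    using keys_hmonom wt_hmonom[OF assms(1) _ assms(2)] by auto
qed

lemma peval_eq_eval: "peval z F = eval z F"
  by (simp add: peval_def eval_def meval_def)

definition swap_mat :: "real^3^3" where
  "swap_mat = vector [vector [0, 0, 1], vector [0, 1, 0], vector [1, 0, 0]]"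

lemma swap_mat_square: "swap_mat ** swap_mat = mat 1"
  by (simp add: swap_mat_def matrix_matrix_mult_def mat_def vec_eq_iff forall_3 sum_3)

lemma invertible_swap_mat: "invertible swap_mat"
  using swap_mat_square invertible_def by blast

lemma matrix_inv_eqI:
  fixes A B :: "real^3^3"
  assumes "A ** B = mat 1" "B ** A = mat 1"
  shows "matrix_inv A = B"
proof -
  have "invertible A" using assms invertible_def by blast
  then have "matrix_inv A ** A = mat 1" by (rule matrix_inv_inverse)
  then show ?thesis using assms
    by (metis matrix_mul_assoc matrix_mul_lid matrix_mul_rid)
qed

lemma joint_invariantsD:
  assumes "F \<in> joint_invariants n" "invertible T" "\<And>i. i \<in> {1..n} \<Longrightarrow> hscale T z i \<noteq> 0"
  shows "eval (act T z) F = eval z F"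
proof -
  let ?R = "{(T, T'). T \<in> GL3 \<and> T' \<in> GL3 \<and> (\<exists>c. c \<noteq> 0 \<and> T' = c *\<^sub>R T)}"
  have A: "?R `` {T} \<in> PGL3"
    unfolding PGL3_def by (rule quotientI) (simp add: GL3_def assms)
  have B: "T \<in> ?R `` {T}"
    using assms(2) by (auto simp: GL3_def intro!: exI[of _ 1])
  have C: "\<forall>g\<in>PGL3. \<forall>T\<in>g. \<forall>z. (\<forall>i\<in>{1..n}. hscale T z i \<noteq> 0) \<longrightarrow> eval (act T z) F = eval z F"
    using assms(1) by (simp add: joint_invariants_def peval_eq_eval)
  have "\<forall>z. (\<forall>i\<in>{1..n}. hscale T z i \<noteq> 0) \<longrightarrow> eval (act T z) F = eval z F"
    by (rule bspec[OF bspec[OF C A] B])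
  with assms(3) show ?thesis by simp
qed

lemma act_swap:
  "act swap_mat z (Xv i) = 1 / z (Xv i)" "act swap_mat z (Yv i) = z (Yv i) / z (Xv i)"
  "act swap_mat z (Pv i) = z (Xv i) * chart z (Cov 3 i)" "act swap_mat z (Qv i) = z (Xv i) * z (Qv i)"
  "hscale swap_mat z i = z (Xv i)"
  using matrix_inv_eqI[OF swap_mat_square swap_mat_square]
  by (simp_all add: swap_mat_def matrix_vector_mult_def vector_matrix_mult_def sum_3 pt_def covec_def hscale_def)

lemma eval_hpoly_chart:
  assumes "F \<in> jet_ring n"
  shows "eval (chart z) (hpoly 1 2 3 {1..n} N F) = eval z F"
proof -
  have "meval (chart z) (hmonom 1 2 3 {1..n} N m) = meval z m" if "m \<in> keys F" for m
    using assms that by (subst meval_jet[of m n]) (auto simp: jet_ring_def meval_hmonom)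
  then show ?thesis
    by (simp add: hpoly_def eval_def[of z F])
qed

text \<open>After the swap \<open>z (Xv i)\<close> is a denominator of the point coordinates and a
  factor of the derivatives. As \<open>N\<close> bounds the degree, its \<open>N\<close>-th power
  clears the denominators.\<close>

lemma eval_hpoly_swap:
  assumes "F \<in> jet_ring n" "\<And>m. m \<in> keys F \<Longrightarrow> mdeg m \<le> N" "\<And>i. i \<in> {1..n} \<Longrightarrow> z (Xv i) \<noteq> 0"
  shows "eval (chart z) (hpoly 3 2 1 {1..n} N F) = (\<Prod>i\<in>{1..n}. z (Xv i) ^ N) * eval (act swap_mat z) F"
proof -
  have "meval (chart z) (hmonom 3 2 1 {1..n} N m) = (\<Prod>i\<in>{1..n}. z (Xv i) ^ N) * meval (act swap_mat z) m"
    if m: "m \<in> keys F" for m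
  proof -
    have "keys m \<subseteq> jet_vars n" using assms(1) m by (auto simp: jet_ring_def)
    then show ?thesis
      unfolding meval_hmonom meval_jet[OF \<open>keys m \<subseteq> jet_vars n\<close>] prod.distrib [symmetric]
    proof (intro prod.cong refl)
      fix i assume i: "i \<in> {1..n}"
      define x where "x = z (Xv i)"
      have x: "x \<noteq> 0" using assms(3)[OF i] by (simp add: x_def)
      define a b c d where abcd: "a = lookup m (Xv i)" "b = lookup m (Yv i)" "c = lookup m (Pv i)" "d = lookup m (Qv i)"
      have "a + b \<le> N" using lookup_add_le_mdeg[of "Xv i" "Yv i" m] assms(2)[OF m] by (simp add: abcd)
      then have "x ^ (N + c + d - a - b) = x ^ N * x ^ c * x ^ d / x ^ a / x ^ b"
        using x by (simp add: power_diff power_add)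
      then show "chart z (Vec 3 i) ^ lookup m (Xv i) * chart z (Vec 2 i) ^ lookup m (Yv i) *
         chart z (Cov 3 i) ^ lookup m (Pv i) * chart z (Cov 2 i) ^ lookup m (Qv i) *
         chart z (Vec 1 i) ^ (N + lookup m (Pv i) + lookup m (Qv i) - lookup m (Xv i) - lookup m (Yv i)) =
         z (Xv i) ^ N * (act swap_mat z (Xv i) ^ lookup m (Xv i) * act swap_mat z (Yv i) ^ lookup m (Yv i) *
          act swap_mat z (Pv i) ^ lookup m (Pv i) * act swap_mat z (Qv i) ^ lookup m (Qv i))"
        unfolding act_swap abcd [symmetric] x_def [symmetric] chart_simps
        by (simp add: power_mult_distrib power_divide x_def[symmetric] del: chart_simps)
    qed
  qed
  then show ?thesis
    by (simp add: hpoly_def eval_def[of _ F] sum_distrib_left mult_ac)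
qed

definition vmonom :: "3 \<Rightarrow> nat set \<Rightarrow> nat \<Rightarrow> (3 hvar \<Rightarrow>\<^sub>0 nat)" where
  "vmonom k I N = (\<Sum>i\<in>I. single (Vec k i) N)"

lemma lookup_vmonom: "finite I \<Longrightarrow> lookup (vmonom k I N) v = (if v \<in> Vec k ` I then N else 0)"
proof -
  assume I: "finite I"
  have "lookup (vmonom k I N) v = (\<Sum>i\<in>I. if Vec k i = v then N else 0)"
    by (simp add: vmonom_def lookup_sum lookup_single when_def)
  also have "\<dots> = (if v \<in> Vec k ` I then N else 0)"
  proof (cases v)
    case (Vec l j)
    have "(\<Sum>i\<in>I. if Vec k i = v then N else 0) = (\<Sum>i\<in>I. if i = j then if l = k then N else 0 else 0)"
      using Vec by (intro sum.cong) auto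
    then show ?thesis using Vec I by auto
  qed auto
  finally show ?thesis .
qed

lemma meval_vmonom: "meval z (vmonom k I N) = (\<Prod>i\<in>I. z (Vec k i) ^ N)"
  by (simp add: vmonom_def meval_sum)

lemma wt_vmonom: "finite I \<Longrightarrow> i \<in> I \<Longrightarrow> wt i (vmonom k I N) = int N"
  by (simp add: vmonom_def wt_sum)

lemma keys_vmonom: "finite I \<Longrightarrow> keys (vmonom k I N) \<subseteq> hvars I"
  by (auto simp: in_keys_iff lookup_vmonom split: if_splits)

lemma homogeneous_vmonom_mult:
  assumes "finite I" "homogeneous I M Q"
  shows "homogeneous I (int N + M) (single (vmonom k I N) 1 * Q)"
  using assms keys_vmonom[OF assms(1), of k N] wt_vmonom[OF assms(1)]
  by (auto simp: homogeneous_def keys_single_mult dest!: subsetD[OF keys_add])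

lemma normal_vmonom_add:
  assumes "finite I" "k \<noteq> 2" "normal I m"
  shows "normal I (vmonom k I N + m)"
  using assms by (auto simp: normal_def lookup_add lookup_vmonom)

text \<open>Normal forms make the coordinate ring of the incidence variety free over the polynomial ring
  in the coordinates 1 and 3 of the vectors, hence the two denominators \<open>vmonom 1\<close> and
  \<open>vmonom 3\<close> are coprime.\<close>

lemma invariant_lift:
  assumes F: "F \<in> joint_invariants n"
  obtains P where "homogeneous {1..n} 0 P" "\<And>z. eval (chart z) P = eval z F"
proof -
  define I where "I = {1..n}"
  have I: "finite I" by (simp add: I_def)
  define N where "N = Max (mdeg ` keys F)"
  have N: "mdeg m \<le> N" if "m \<in> keys F" for m using that by (simp add: N_def)
  have F': "F \<in> jet_ring n" using F by (simp add: joint_invariants_def)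
  obtain Q1 where Q1: "homogeneous I (int N) Q1" "\<And>m. m \<in> keys Q1 \<Longrightarrow> normal I m"
      "\<And>z. incident I z \<Longrightarrow> eval z Q1 = eval z (hpoly 1 2 3 I N F)"
    using normal_form[OF I homogeneous_hpoly[OF I N]] by metis
  obtain Q3 where Q3: "homogeneous I (int N) Q3" "\<And>m. m \<in> keys Q3 \<Longrightarrow> normal I m"
      "\<And>z. incident I z \<Longrightarrow> eval z Q3 = eval z (hpoly 3 2 1 I N F)"
    using normal_form[OF I homogeneous_hpoly[OF I N]] by metis
  \<comment> \<open>The lifts \<open>Q1\<close> over the third coordinates and \<open>Q3\<close>
    over the first coordinates, each to the power \<open>N\<close>, both represent \<open>F\<close>;
    \<open>R\<close> is their difference after cross-multiplication.\<close>
  define R where "R = single (vmonom 1 I N) 1 * Q1 - single (vmonom 3 I N) 1 * Q3"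
  have keys_R: "keys R \<subseteq> keys (single (vmonom 1 I N) 1 * Q1) \<union> keys (single (vmonom 3 I N) 1 * Q3)"
    unfolding R_def by (rule keys_diff_subset)
  have R_hom: "homogeneous I (int N + int N) R"
    using homogeneous_vmonom_mult[OF I Q1(1), of N 1] homogeneous_vmonom_mult[OF I Q3(1), of N 3] keys_R
    by (auto simp: homogeneous_def)
  have R_normal: "normal I m" if "m \<in> keys R" for m
    using that keys_R Q1(2) Q3(2) by (auto simp: keys_single_mult intro!: normal_vmonom_add I)
  have chart_R: "eval (chart z) R = 0" if "\<forall>i\<in>I. z (Xv i) \<noteq> 0" for z
  proof -
    have "eval (chart z) (hpoly 3 2 1 I N F) = (\<Prod>i\<in>I. z (Xv i) ^ N) * eval (act swap_mat z) F"
      unfolding I_def by (rule eval_hpoly_swap[OF F' N]) (use that I_def in auto)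
    also have "eval (act swap_mat z) F = eval z F"
      by (rule joint_invariantsD[OF F invertible_swap_mat]) (use that I_def act_swap in auto)
    finally show ?thesis
      using eval_hpoly_chart[OF F', of z N]
      by (simp add: R_def Q1(3)[OF incident_chart] Q3(3)[OF incident_chart] meval_vmonom I_def)
  qed
  \<comment> \<open>The factor \<open>u\<close> vanishes wherever a first or third vector coordinate
    does, so only points that rescale into the chart remain to be checked.\<close>
  define u where "u = vmonom 1 I 1 + vmonom 3 I 1"
  have "single u 1 * R = 0"
  proof (rule normal_form_unique[OF I])
    fix m assume "m \<in> keys (single u 1 * R)"
    then obtain m' where m': "m = vmonom 1 I 1 + (vmonom 3 I 1 + m')" "m' \<in> keys R"
      by (auto simp: keys_single_mult u_def add.assoc)
    show "keys m \<subseteq> hvars I"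
      using R_hom m' keys_vmonom[OF I, of _ 1]
      unfolding homogeneous_def by (auto simp: m' dest!: subsetD[OF keys_add])
    show "normal I m"
      unfolding m' by (intro normal_vmonom_add I R_normal m') auto
  next
    fix z assume z: "incident I z"
    show "eval z (single u 1 * R) = 0"
    proof (cases "\<forall>i\<in>I. z (Vec 1 i) \<noteq> 0 \<and> z (Vec 3 i) \<noteq> 0")
      case False
      then show ?thesis using I by (auto simp: u_def meval_add meval_vmonom)
    next
      case True
      \<comment> \<open>Normalizes the third coordinates to one; \<open>w\<close> is the affine
        configuration obtained in this way.\<close>
      define c where "c i = 1 / z (Vec 3 i)" for i
      have c: "c i \<noteq> 0" if "i \<in> I" for i using True that by (simp add: c_def)
      define w where "w v = (case v of Xv i \<Rightarrow> c i * z (Vec 1 i) | Yv i \<Rightarrow> c i * z (Vec 2 i)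
        | Pv i \<Rightarrow> z (Cov 1 i) / c i | Qv i \<Rightarrow> z (Cov 2 i) / c i)" for v
      have "chart w v = rescale c z v" if v: "v \<in> hvars I" for v
      proof -
        have "z (Cov 3 i) * z (Vec 3 i) = - z (Cov 1 i) * z (Vec 1 i) - z (Cov 2 i) * z (Vec 2 i)" if "i \<in> I" for i
          using z that by (simp add: incident_def sum_3 algebra_simps add_eq_0_iff)
        then have "chart w (Vec k i) = rescale c z (Vec k i) \<and> chart w (Cov k i) = rescale c z (Cov k i)"
          if "i \<in> I" for i k
          using exhaust_3[of k] that True by (auto simp: rescale_def w_def c_def field_simps)
        then show ?thesis using v by (auto simp: hvars_def)
      qed
      then have "eval (chart w) R = eval (rescale c z) R"
        using R_hom by (intro eval_cong) (auto simp: homogeneous_def)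
      moreover have "eval (chart w) R = 0"
        by (rule chart_R) (use True c in \<open>auto simp: w_def\<close>)
      moreover have "eval (rescale c z) R = (\<Prod>i\<in>I. c i powi (int N + int N)) * eval z R"
        by (rule eval_rescale[OF I c R_hom])
      ultimately have "eval z R = 0" using c I by simp
      then show ?thesis by simp
    qed
  qed
  then have "R = 0" by (simp add: single_mult_eq_0_iff)
  then have "keys (single (vmonom 1 I N) 1 * Q1) = keys (single (vmonom 3 I N) 1 * Q3)"
    by (simp add: R_def)
  then have eq: "(+) (vmonom 1 I N) ` keys Q1 = (+) (vmonom 3 I N) ` keys Q3"
    by (simp add: keys_single_mult)
  have div: "vmonom 3 I N + (m - vmonom 3 I N) = m" if m: "m \<in> keys Q1" for m
  proof -
    obtain m' where m': "vmonom 1 I N + m = vmonom 3 I N + m'" using eq m by blast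
    \<comment> \<open>\<open>vmonom 1 I N\<close> does not involve \<open>Vec 3 i\<close>, so its
      exponent on the right must come from \<open>m\<close> itself.\<close>
    have "N \<le> lookup m (Vec 3 i)" if "i \<in> I" for i
    proof -
      have "lookup (vmonom 1 I N + m) (Vec 3 i) = lookup (vmonom 3 I N + m') (Vec 3 i)" using m' by simp
      then show ?thesis using that by (simp add: lookup_add lookup_vmonom[OF I] image_iff)
    qed
    then show ?thesis
      by (intro poly_mapping_eqI) (auto simp: lookup_add lookup_minus lookup_vmonom[OF I])
  qed
  \<comment> \<open>The quotient of \<open>Q1\<close> by the power of the third coordinates;
    \<open>div\<close> makes the truncated subtraction exact.\<close>
  define P where "P = (\<Sum>m\<in>keys Q1. single (m - vmonom 3 I N) (lookup Q1 m))"
  have "homogeneous I 0 P"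
    unfolding homogeneous_def
  proof
    fix m' assume "m' \<in> keys P"
    then obtain m where m: "m \<in> keys Q1" "m' = m - vmonom 3 I N"
      unfolding P_def using keys_sum_subset_UN[of "\<lambda>m. single (m - vmonom 3 I N) (lookup Q1 m)" "keys Q1"]
      by (auto split: if_splits)
    have "keys m' \<subseteq> keys m" by (auto simp: m in_keys_iff lookup_minus)
    moreover have "keys m \<subseteq> hvars I" using Q1(1) m by (simp add: homogeneous_def)
    moreover have "wt i m' = 0" if "i \<in> I" for i
    proof -
      have "wt i (vmonom 3 I N + m') = wt i m" using div[OF m(1)] m(2) by simp
      then show ?thesis using wt_vmonom[OF I that] Q1(1) m(1) that by (simp add: homogeneous_def)
    qed
    ultimately show "keys m' \<subseteq> hvars I \<and> (\<forall>i\<in>I. wt i m' = 0)" by blast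
  qed
  moreover have "eval (chart z) P = eval z F" for z
  proof -
    have "meval (chart z) (m - vmonom 3 I N) = meval (chart z) m" if "m \<in> keys Q1" for m
    proof -
      have "meval (chart z) m = meval (chart z) (vmonom 3 I N + (m - vmonom 3 I N))"
        by (simp add: div[OF that])
      then show ?thesis by (simp add: meval_add meval_vmonom)
    qed
    then have "eval (chart z) P = eval (chart z) Q1"
      by (simp add: P_def eval_def[of _ Q1])
    then show ?thesis
      using Q1(3)[OF incident_chart] eval_hpoly_chart[OF F', of z N] by (simp add: I_def)
  qed
  ultimately show ?thesis using that by (simp add: I_def)
qed


section \<open>Balanced products of pairings\<close>

text \<open>The orbit of \<open>v\<close> stays in a finite set, so it repeats; the stretch up to
  the first repetition is the cycle.\<close>

lemma function_cycle:
  assumes "finite V" "v \<in> V" and f: "\<And>u. u \<in> V \<Longrightarrow> f u \<in> V"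
  obtains cs where "cs \<noteq> []" "distinct cs" "set cs \<subseteq> V"
    "\<And>k. k < length cs \<Longrightarrow> cs ! (Suc k mod length cs) = f (cs ! k)"
proof -
  define g where "g k = (f ^^ k) v" for k
  have gV: "g k \<in> V" for k by (induction k) (auto simp: g_def assms)
  have "\<not> inj g"
    using finite_subset[of "range g" V] gV assms(1) range_inj_infinite[of g] by blast
  then have ex: "\<exists>j. \<exists>i<j. g i = g j"
    by (metis linorder_injI)
  \<comment> \<open>Minimality of \<open>j\<close> makes the iterates before it pairwise
    distinct.\<close>
  define j where "j = (LEAST j. \<exists>i<j. g i = g j)"
  obtain i where i: "i < j" "g i = g j"
    using LeastI_ex[OF ex] unfolding j_def by blast
  have "inj_on g {..<j}"
  proof (rule linorder_inj_onI)
    fix a b assume "a < b" "a \<in> {..<j}" "b \<in> {..<j}"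
    then show "g a \<noteq> g b" using not_less_Least[of b "\<lambda>j. \<exists>i<j. g i = g j"] by (auto simp: j_def)
  qed auto
  then have "inj_on g {i..<j}" by (rule inj_on_subset) auto
  define cs where "cs = map g [i..<j]"
  have len: "length cs = j - i" by (simp add: cs_def)
  show ?thesis
  proof (rule that)
    show "cs \<noteq> []" using i by (simp add: cs_def)
    show "distinct cs" using \<open>inj_on g {i..<j}\<close> by (simp add: cs_def distinct_map)
    show "set cs \<subseteq> V" using gV by (auto simp: cs_def)
    fix k assume k: "k < length cs"
    show "cs ! (Suc k mod length cs) = f (cs ! k)"
    proof (cases "Suc k < length cs")
      case True
      then show ?thesis by (simp add: cs_def g_def)
    next
      case False
      then have "Suc k = length cs" "i + Suc k = j" using k len by auto
      then have "cs ! (Suc k mod length cs) = g i" using i by (simp add: cs_def)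
      also have "\<dots> = f (g (i + k))" using i \<open>i + Suc k = j\<close> by (auto simp: g_def)
      also have "g (i + k) = cs ! k" using k len by (simp add: cs_def)
      finally show ?thesis .
    qed
  qed
qed

definition cycle_edges :: "nat list \<Rightarrow> (nat \<times> nat) list" where
  "cycle_edges cs = zip cs (rotate1 cs)"

lemma mset_cycle_edges:
  "image_mset fst (mset (cycle_edges cs)) = mset cs" "image_mset snd (mset (cycle_edges cs)) = mset cs"
  by (simp_all add: cycle_edges_def flip: mset_map) (cases cs, auto)

lemma distinct_cycle_edges: "distinct cs \<Longrightarrow> distinct (cycle_edges cs)"
  by (simp add: cycle_edges_def distinct_zipI1)

lemma nth_cycle_edges: "k < length cs \<Longrightarrow> cycle_edges cs ! k = (cs ! k, cs ! (Suc k mod length cs))"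
  by (simp add: cycle_edges_def nth_rotate1)

lemma length_cycle_edges [simp]: "length (cycle_edges cs) = length cs"
  by (simp add: cycle_edges_def)

text \<open>A monomial in the \<open>Cpoly i j\<close> is encoded as a directed multigraph on the
  points; a multiset allows repeated factors.\<close>

definition edge_poly :: "(nat \<times> nat) multiset \<Rightarrow> jet_poly" where
  "edge_poly E = (\<Prod>(i, j)\<in>#E. Cpoly i j)"

lemma Zpoly_eq_edge_poly: "Zpoly cs = edge_poly (mset (cycle_edges cs))"
proof -
  have "edge_poly (mset (cycle_edges cs)) = prod_list (map (\<lambda>(i, j). Cpoly i j) (cycle_edges cs))"
    by (simp add: edge_poly_def flip: mset_map prod_mset_prod_list)
  also have "\<dots> = (\<Prod>k<length cs. case cycle_edges cs ! k of (i, j) \<Rightarrow> Cpoly i j)"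
    by (simp add: prod.list_conv_set_nth atLeast0LessThan)
  also have "\<dots> = Zpoly cs"
    unfolding Zpoly_def by (intro prod.cong) (auto simp: nth_cycle_edges)
  finally show ?thesis by simp
qed

lemma Zpoly_in_cyclic_invariants:
  assumes "distinct cs" "2 \<le> length cs" "set cs \<subseteq> {1..n}"
  shows "Zpoly cs \<in> cyclic_invariants n"
  unfolding cyclic_invariants_def using assms cycle_permutes permutes_subset by blast

text \<open>Equal in- and out-degrees let every edge be continued, so some cycle exists; splitting
  it off keeps the balance. A loop makes the whole product zero.\<close>

lemma balanced_edge_poly:
  assumes "image_mset fst E = image_mset snd E" "set_mset E \<subseteq> {1..n} \<times> {1..n}"
  shows "edge_poly E \<in> generated_subalgebra (cyclic_invariants n)"
  using assms
proof (induction "size E" arbitrary: E rule: less_induct)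
  case less
  show ?case
  proof (cases "E = {#}")
    case True
    then show ?thesis
      using generated_subalgebra.const[of 1] by (simp add: edge_poly_def pconst_def)
  next
    case nonempty: False
    show ?thesis
    proof (cases "\<exists>i. (i, i) \<in># E")
      case True
      then have "edge_poly E = 0"
        by (force simp: edge_poly_def prod_mset_zero_iff Cpoly_def dest: multi_member_split)
      then show ?thesis
        using generated_subalgebra.const[of 0] by (simp add: pconst_def)
    next
      case False
      define V where "V = fst ` set_mset E"
      have V_snd: "V = snd ` set_mset E"
        using arg_cong[OF less.prems(1), of set_mset] by (simp add: V_def)
      have "\<forall>u\<in>V. \<exists>w. (u, w) \<in># E" by (auto simp: V_def)
      then obtain f where f: "\<And>u. u \<in> V \<Longrightarrow> (u, f u) \<in># E" by metis
      have fV: "f u \<in> V" if "u \<in> V" for u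
        using f[OF that] unfolding V_snd by force
      have "V \<noteq> {}" using nonempty by (simp add: V_def)
      then obtain v where "v \<in> V" by blast
      then obtain cs where cs: "cs \<noteq> []" "distinct cs" "set cs \<subseteq> V"
          "\<And>k. k < length cs \<Longrightarrow> cs ! (Suc k mod length cs) = f (cs ! k)"
        using function_cycle[of V v f] fV by (auto simp: V_def)
      have edges: "e \<in># E" if e: "e \<in> set (cycle_edges cs)" for e
      proof -
        obtain k where "k < length (cycle_edges cs)" "cycle_edges cs ! k = e"
          using e unfolding in_set_conv_nth by blast
        then have k: "k < length cs" "e = cycle_edges cs ! k" by auto
        then have "e = (cs ! k, f (cs ! k))" using cs(4) by (simp add: nth_cycle_edges)
        then show ?thesis using f cs(3) k(1) by (auto simp: subset_iff)
      qed
      \<comment> \<open>The edges of the cycle are distinct, so membership in \<open>E\<close>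
        already gives inclusion with multiplicities.\<close>
      have "mset (cycle_edges cs) = mset_set (set (cycle_edges cs))"
        by (simp add: mset_set_set distinct_cycle_edges cs(2))
      also have "\<dots> \<subseteq># mset_set (set_mset E)"
        using edges by (intro subset_imp_msubset_mset_set) auto
      also have "\<dots> \<subseteq># E" by (rule mset_set_set_mset_msubset)
      finally obtain E' where E': "E = mset (cycle_edges cs) + E'"
        by (metis subset_mset.le_iff_add)
      have "2 \<le> length cs"
      proof (rule ccontr)
        assume "\<not> 2 \<le> length cs"
        then have "length cs = 1" using cs(1) by (simp add: not_le less_2_cases_iff)
        then have "cycle_edges cs ! 0 = (cs ! 0, cs ! 0)" by (simp add: nth_cycle_edges)
        then have "(cs ! 0, cs ! 0) \<in># E"
          using edges[OF nth_mem, of 0] \<open>length cs = 1\<close> by simp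
        then show False using False by blast
      qed
      moreover have "V \<subseteq> {1..n}" unfolding V_def using less.prems(2) by fastforce
      then have "set cs \<subseteq> {1..n}" using cs(3) by blast
      ultimately have Z: "Zpoly cs \<in> cyclic_invariants n"
        using cs(2) by (intro Zpoly_in_cyclic_invariants)
      have "edge_poly E' \<in> generated_subalgebra (cyclic_invariants n)"
      proof (rule less.hyps)
        show "size E' < size E" using cs(1) by (simp add: E')
        show "image_mset fst E' = image_mset snd E'"
          using less.prems(1) by (simp add: E' mset_cycle_edges)
        show "set_mset E' \<subseteq> {1..n} \<times> {1..n}" using less.prems(2) by (simp add: E')
      qed
      moreover have "edge_poly E = Zpoly cs * edge_poly E'"
        by (simp add: Zpoly_eq_edge_poly edge_poly_def E')
      ultimately show ?thesis
        using Z by (simp add: generated_subalgebra.gen generated_subalgebra.mult)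
    qed
  qed
qed


section \<open>The cyclic invariants are invariant\<close>

lemma pvar_eq_var: "pvar v = var v"
  by (simp add: pvar_def var_def)

lemma eval_Cpoly: "eval z (Cpoly i j) = (\<Sum>k\<in>UNIV. chart z (Cov k i) * chart z (Vec k j))"
  by (simp add: Cpoly_def pvar_eq_var sum_3 algebra_simps)

text \<open>The action before division by the third coordinate, that is, before returning to the
  affine chart.\<close>

definition linact :: "real^3^3 \<Rightarrow> (jet_var \<Rightarrow> real) \<Rightarrow> 3 hvar \<Rightarrow> real" where
  "linact T z v = (case v of Vec k i \<Rightarrow> (T *v pt z i) $ k | Cov k i \<Rightarrow> (covec z i v* matrix_inv T) $ k)"

lemma inner_vector_matrix:
  fixes x y :: "real^3" and A :: "real^3^3"
  shows "(x v* A) \<bullet> y = x \<bullet> (A *v y)"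
  by (simp add: dot_lmul_matrix)

lemma linact_pairing:
  assumes "invertible T"
  shows "(\<Sum>k\<in>UNIV. linact T z (Cov k i) * linact T z (Vec k j)) = eval z (Cpoly i j)"
proof -
  have "(\<Sum>k\<in>UNIV. linact T z (Cov k i) * linact T z (Vec k j)) = (covec z i v* matrix_inv T) \<bullet> (T *v pt z j)"
    by (simp add: linact_def inner_vec_def)
  also have "\<dots> = covec z i \<bullet> pt z j"
    by (simp add: inner_vector_matrix matrix_vector_mul_assoc matrix_inv_inverse[OF assms])
  also have "\<dots> = eval z (Cpoly i j)"
    by (simp add: eval_Cpoly chart_def inner_vec_def)
  finally show ?thesis .
qed

lemma Cpoly_same [simp]: "Cpoly i i = 0"
  by (simp add: Cpoly_def)

lemma hscale_eq: "hscale T z i = (T *v pt z i) $ 3"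
  by (simp add: hscale_def matrix_vector_mult_def sum_3 pt_def)

lemma chart_act:
  assumes "invertible T" "hscale T z i \<noteq> 0"
  shows "chart (act T z) (Vec k i) = rescale (\<lambda>i. 1 / hscale T z i) (linact T z) (Vec k i)"
    and "chart (act T z) (Cov k i) = rescale (\<lambda>i. 1 / hscale T z i) (linact T z) (Cov k i)"
proof -
  let ?l = "linact T z"
  \<comment> \<open>The third covector coordinate is not a jet coordinate; it is recovered from
    incidence, which the linear action preserves.\<close>
  have "(\<Sum>k\<in>UNIV. ?l (Cov k i) * ?l (Vec k i)) = 0"
    using linact_pairing[OF assms(1), of z i i] by simp
  then have "?l (Cov 3 i) * hscale T z i = - ?l (Cov 1 i) * ?l (Vec 1 i) - ?l (Cov 2 i) * ?l (Vec 2 i)"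
    by (simp add: sum_3 linact_def hscale_eq algebra_simps add_eq_0_iff)
  then show "chart (act T z) (Cov k i) = rescale (\<lambda>i. 1 / hscale T z i) ?l (Cov k i)"
    using exhaust_3[of k] assms(2)
    by (auto simp: rescale_def linact_def field_simps)
  show "chart (act T z) (Vec k i) = rescale (\<lambda>i. 1 / hscale T z i) ?l (Vec k i)"
    using exhaust_3[of k] assms(2)
    by (auto simp: rescale_def linact_def hscale_eq)
qed

text \<open>The covector at \<open>i\<close> is rescaled by \<open>hscale T z i\<close>, the vector
  at \<open>j\<close> by the inverse of \<open>hscale T z j\<close>, and their pairing is otherwise
  preserved.\<close>

lemma eval_Cpoly_act:
  assumes "invertible T" "hscale T z i \<noteq> 0" "hscale T z j \<noteq> 0"
  shows "eval (act T z) (Cpoly i j) = hscale T z i / hscale T z j * eval z (Cpoly i j)"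
proof -
  have "eval (act T z) (Cpoly i j) = (\<Sum>k\<in>UNIV. hscale T z i / hscale T z j * (linact T z (Cov k i) * linact T z (Vec k j)))"
    unfolding eval_Cpoly chart_act(1)[OF assms(1,3)] chart_act(2)[OF assms(1,2)] by (simp add: rescale_def mult_ac)
  then show ?thesis
    by (simp only: linact_pairing[OF assms(1)] sum_distrib_left [symmetric])
qed

lemma bij_betw_Suc_mod: "bij_betw (\<lambda>k. Suc k mod n) {..<n} {..<n}"
proof (cases "n = 0")
  case False
  have "inj_on (\<lambda>k. Suc k mod n) {..<n}"
    by (rule inj_onI) (auto simp: mod_Suc split: if_splits)
  moreover have "(\<lambda>k. Suc k mod n) ` {..<n} \<subseteq> {..<n}" using False by auto
  ultimately show ?thesis
    by (simp add: bij_betw_def endo_inj_surj)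
qed simp

text \<open>Around a cycle every point occurs once as source and once as target, so the scale
  factors cancel.\<close>

lemma eval_Zpoly_act:
  assumes "invertible T" "\<And>i. i \<in> set cs \<Longrightarrow> hscale T z i \<noteq> 0"
  shows "eval (act T z) (Zpoly cs) = eval z (Zpoly cs)"
proof -
  let ?s = "\<lambda>k. hscale T z (cs ! k)" and ?n = "length cs"
  have "eval (act T z) (Zpoly cs) = (\<Prod>k<?n. ?s k / ?s (Suc k mod ?n) * eval z (Cpoly (cs ! k) (cs ! (Suc k mod ?n))))"
    unfolding Zpoly_def eval_prod
    by (intro prod.cong refl eval_Cpoly_act assms nth_mem) (auto intro: mod_less_divisor)
  also have "\<dots> = (\<Prod>k<?n. ?s k) / (\<Prod>k<?n. ?s (Suc k mod ?n)) * eval z (Zpoly cs)"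
    by (simp add: Zpoly_def prod.distrib prod_dividef)
  also have "(\<Prod>k<?n. ?s (Suc k mod ?n)) = (\<Prod>k<?n. ?s k)"
    by (rule prod.reindex_bij_betw[OF bij_betw_Suc_mod])
  also have "(\<Prod>k<?n. ?s k) \<noteq> 0" using assms(2) by simp
  then have "(\<Prod>k<?n. ?s k) / (\<Prod>k<?n. ?s k) * eval z (Zpoly cs) = eval z (Zpoly cs)" by simp
  finally show ?thesis .
qed

lemma cycle_in_range:
  assumes "cycle_of_list cs permutes S" "distinct cs" "2 \<le> length cs"
  shows "set cs \<subseteq> S"
proof
  fix x assume "x \<in> set cs"
  then obtain k where k: "k < length cs" "x = cs ! k" by (auto simp: in_set_conv_nth)
  have "map (cycle_of_list cs) cs = rotate1 cs"
    using cyclic_rotation[OF assms(2), of 1] by simp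
  then have "cycle_of_list cs x = cs ! (Suc k mod length cs)"
    using k by (metis nth_map nth_rotate1)
  also have "\<dots> \<noteq> cs ! k"
    using assms k by (subst nth_eq_iff_index_eq) (auto simp: mod_Suc split: if_splits)
  finally show "x \<in> S"
    using permutes_not_in[OF assms(1)] k by metis
qed

lemma cyclic_invariantsE:
  assumes "G \<in> cyclic_invariants n"
  obtains cs where "G = Zpoly cs" "set cs \<subseteq> {1..n}"
  using assms cycle_in_range unfolding cyclic_invariants_def by blast

lemma eval_generated_act:
  assumes "G \<in> generated_subalgebra (cyclic_invariants n)"
    and T: "invertible T" "\<And>i. i \<in> {1..n} \<Longrightarrow> hscale T z i \<noteq> 0"
  shows "eval (act T z) G = eval z G"
  using assms(1)
proof induction
  case (const a)
  then show ?case by (simp add: pconst_def)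
next
  case (gen F)
  then obtain cs where "F = Zpoly cs" "set cs \<subseteq> {1..n}" by (rule cyclic_invariantsE)
  then show ?case using T by (auto intro!: eval_Zpoly_act)
qed auto

lemma jet_ring_add: "F \<in> jet_ring n \<Longrightarrow> G \<in> jet_ring n \<Longrightarrow> F + G \<in> jet_ring n"
  using keys_add[of F G] by (auto simp: jet_ring_def)

lemma jet_ring_diff: "F \<in> jet_ring n \<Longrightarrow> G \<in> jet_ring n \<Longrightarrow> F - G \<in> jet_ring n"
  using keys_diff_subset[of F G] by (auto simp: jet_ring_def)

lemma jet_ring_mult:
  assumes "F \<in> jet_ring n" "G \<in> jet_ring n"
  shows "F * G \<in> jet_ring n"
  unfolding jet_ring_def
proof (intro CollectI ballI)
  fix m assume "m \<in> keys (F * G)"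
  then obtain a b where "m = a + b" "a \<in> keys F" "b \<in> keys G" using keys_mult[of F G] by auto
  then show "keys m \<subseteq> jet_vars n"
    using assms keys_add[of a b] unfolding jet_ring_def by blast
qed

lemma jet_ring_pconst: "pconst a \<in> jet_ring n"
  by (simp add: jet_ring_def pconst_def)

lemma jet_ring_pvar: "v \<in> jet_vars n \<Longrightarrow> pvar v \<in> jet_ring n"
  by (simp add: jet_ring_def pvar_def)

lemma jet_ring_Cpoly: "i \<in> {1..n} \<Longrightarrow> j \<in> {1..n} \<Longrightarrow> Cpoly i j \<in> jet_ring n"
  unfolding Cpoly_def
  by (intro jet_ring_add jet_ring_mult jet_ring_diff jet_ring_pvar) (auto simp: jet_vars_def)

lemma jet_ring_Zpoly:
  assumes "set cs \<subseteq> {1..n}"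
  shows "Zpoly cs \<in> jet_ring n"
proof -
  \<comment> \<open>Induction over sets of indices leaves \<open>length cs\<close> in the modulus
    unchanged.\<close>
  have "(\<Prod>k\<in>K. Cpoly (cs ! k) (cs ! (Suc k mod length cs))) \<in> jet_ring n" if "K \<subseteq> {..<length cs}" for K
    using finite_subset[OF that finite_lessThan] that
  proof (induction K rule: finite_induct)
    case empty
    then show ?case using jet_ring_pconst[of 1] by (simp add: pconst_def)
  next
    case (insert k K)
    then have "cs ! k \<in> set cs" "cs ! (Suc k mod length cs) \<in> set cs"
      by (auto intro!: nth_mem mod_less_divisor)
    then show ?case using insert assms by (simp del: One_nat_def add: jet_ring_mult jet_ring_Cpoly subset_iff)
  qed
  then show ?thesis by (simp add: Zpoly_def)
qed

lemma generated_subset_invariants: "generated_subalgebra (cyclic_invariants n) \<subseteq> joint_invariants n"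
proof
  fix G assume G: "G \<in> generated_subalgebra (cyclic_invariants n)"
  then have "G \<in> jet_ring n"
    by induction (auto intro: jet_ring_add jet_ring_mult jet_ring_pconst jet_ring_Zpoly elim: cyclic_invariantsE)
  moreover have "peval (act T z) G = peval z G"
    if "g \<in> PGL3" "T \<in> g" "\<forall>i\<in>{1..n}. hscale T z i \<noteq> 0" for g T z
  proof -
    have "invertible T" using that(1,2) by (auto simp: PGL3_def GL3_def quotient_def)
    then show ?thesis using eval_generated_act[OF G] that(3) by (simp add: peval_eq_eval)
  qed
  ultimately show "G \<in> joint_invariants n" by (simp add: joint_invariants_def)
qed


section \<open>Infinitesimal invariance\<close>

definition Dop :: "nat set \<Rightarrow> 'k \<Rightarrow> 'k \<Rightarrow> 'k hvar mpoly \<Rightarrow> 'k hvar mpoly" where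
  "Dop I k l P = Xop I k l P - Yop I l k P"

lemma fischer_Dop: "fischer (Dop I k l P) Q = fischer P (Dop I l k Q)"
  by (simp add: Dop_def fischer_diff_left fischer_diff_right fischer_Xop fischer_Yop)

text \<open>\<open>Dop I b a\<close> is the derivative of the action at the identity along the elementary matrix with
  entry \<open>(a, b)\<close>; see \<open>eval_Dop_zero\<close>.\<close>

definition balanced_monoms :: "nat set \<Rightarrow> nat \<Rightarrow> (('k::finite) hvar \<Rightarrow>\<^sub>0 nat) set" where
  "balanced_monoms I N = {m. keys m \<subseteq> hvars I \<and> mdeg m \<le> N \<and> (\<forall>i\<in>I. wt i m = 0)}"

lemma finite_balanced_monoms: "finite I \<Longrightarrow> finite (balanced_monoms I N)"
  by (rule finite_subset[OF _ finite_monoms[OF finite_hvars[of I], of N]]) (auto simp: balanced_monoms_def)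

lemma homogeneous_balanced: "keys P \<subseteq> balanced_monoms I N \<Longrightarrow> homogeneous I 0 P"
  by (auto simp: homogeneous_def balanced_monoms_def)

text \<open>One variable is replaced by another of the same weight, so neither degree nor weights
  change.\<close>

lemma keys_var_pd_balanced:
  assumes "keys P \<subseteq> balanced_monoms I N" "u \<in> hvars I"
    and "\<And>i. wt i (single u 1) = wt i (single v 1)"
  shows "keys (var u * pd v P) \<subseteq> balanced_monoms I N"
proof
  fix m assume "m \<in> keys (var u * pd v P)"
  then obtain m' where m': "m = single u 1 + m'" "m' + single v 1 \<in> keys P"
    using keys_pd[of v P] by (auto simp: keys_var_mult)
  then have b: "m' + single v 1 \<in> balanced_monoms I N" using assms(1) by auto
  then have "keys m' \<subseteq> hvars I"
    unfolding balanced_monoms_def by (auto simp: in_keys_iff lookup_add subset_iff)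
  then have "keys m \<subseteq> hvars I"
    using assms(2) keys_add[of "single u 1" m'] by (auto simp: m'(1))
  moreover have "wt i m = wt i (m' + single v 1)" for i
    using assms(3)[of i] by (simp add: m'(1))
  ultimately show "m \<in> balanced_monoms I N"
    using b by (simp add: balanced_monoms_def m'(1) add.commute)
qed

lemma keys_sum_subset:
  fixes f :: "'b \<Rightarrow> 'a \<Rightarrow>\<^sub>0 'c::comm_monoid_add"
  assumes "\<And>a. a \<in> A \<Longrightarrow> keys (f a) \<subseteq> M"
  shows "keys (sum f A) \<subseteq> M"
  by (rule order_trans[OF keys_sum_subset_UN], rule UN_least) (rule assms)

lemma keys_Dop_balanced:
  assumes "keys P \<subseteq> balanced_monoms I N"
  shows "keys (Dop I k l P) \<subseteq> balanced_monoms I N"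
proof -
  have "keys (var (Vec k j) * pd (Vec l j) P) \<subseteq> balanced_monoms I N"
       "keys (var (Cov l j) * pd (Cov k j) P) \<subseteq> balanced_monoms I N" if "j \<in> I" for j
    by (rule keys_var_pd_balanced[OF assms]; simp add: that)+
  then have "keys (Xop I k l P) \<subseteq> balanced_monoms I N" "keys (Yop I l k P) \<subseteq> balanced_monoms I N"
    unfolding Xop_def Yop_def by (simp_all add: keys_sum_subset)
  then show ?thesis unfolding Dop_def using keys_diff_subset[of "Xop I k l P" "Yop I l k P"] by (meson Un_least order_trans)
qed

lemma sum_hvars:
  assumes "finite I"
  shows "(\<Sum>v\<in>hvars I. f v) = (\<Sum>k\<in>UNIV. \<Sum>i\<in>I. f (Vec k i)) + (\<Sum>k\<in>UNIV. \<Sum>i\<in>I. f (Cov (k::'k::finite) i))"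
proof -
  let ?V = "(\<lambda>(k, i). Vec (k::'k) i) ` (UNIV \<times> I)" and ?C = "(\<lambda>(k, i). Cov (k::'k) i) ` (UNIV \<times> I)"
  have "hvars I = ?V \<union> ?C" by (auto simp: hvars_def)
  also have "sum f \<dots> = sum f ?V + sum f ?C"
    using assms by (intro sum.union_disjoint) auto
  also have "sum f ?V = (\<Sum>k\<in>UNIV. \<Sum>i\<in>I. f (Vec k i))"
    by (subst sum.reindex) (auto simp: inj_on_def sum.cartesian_product case_prod_unfold)
  also have "sum f ?C = (\<Sum>k\<in>UNIV. \<Sum>i\<in>I. f (Cov k i))"
    by (subst sum.reindex) (auto simp: inj_on_def sum.cartesian_product case_prod_unfold)
  finally show ?thesis .
qed

section \<open>Curves of elementary matrices through the identity\<close>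

definition elementary :: "3 \<Rightarrow> 3 \<Rightarrow> real \<Rightarrow> real^3^3" where
  "elementary a b t = (\<chi> i j. (if i = j then 1 else 0) + (if i = a \<and> j = b then t else 0))"

lemma elementary_mult:
  "elementary a b s ** elementary a b t = elementary a b (s + t + (if a = b then s * t else 0))"
proof -
  have "(\<Sum>k\<in>UNIV. ((if i = k then 1 else 0) + (if i = a \<and> k = b then s else 0)) *
      ((if k = j then 1 else 0) + (if k = a \<and> j = b then t else 0))) =
      (if i = j then 1 else 0) + (if i = a \<and> j = b then s + t + (if a = b then s * t else 0) else 0)"
    (is "(\<Sum>k\<in>UNIV. ?f k) = _") for i j
  proof -
    have "?f k = (if k = i then (if i = j then 1 else 0) + (if i = a \<and> j = b then t else 0) else 0)
        + (if k = b then (if i = a then s * ((if b = j then 1 else 0) + (if b = a \<and> j = b then t else 0)) else 0) else 0)" for k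
      by (auto simp: algebra_simps)
    then show ?thesis by (auto simp: sum.distrib algebra_simps)
  qed
  then show ?thesis
    by (simp add: elementary_def matrix_matrix_mult_def vec_eq_iff)
qed

lemma elementary_0: "elementary a b 0 = mat 1"
  by (simp add: elementary_def mat_def vec_eq_iff)

text \<open>For \<open>a \<noteq> b\<close> this is a shear, inverted by changing the sign of
  \<open>t\<close>; for \<open>a = b\<close> it is diagonal and the entry \<open>1 + t\<close> is
  inverted.\<close>

lemma matrix_inv_elementary:
  assumes "1 + t \<noteq> 0"
  shows "invertible (elementary a b t)"
    and "matrix_inv (elementary a b t) = elementary a b (- t / (if a = b then 1 + t else 1))"
proof -
  let ?u = "- t / (if a = b then 1 + t else 1)"
  have "t + ?u + (if a = b then t * ?u else 0) = 0" "?u + t + (if a = b then ?u * t else 0) = 0"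
    using assms by (auto simp: field_simps)
  then have *: "elementary a b t ** elementary a b ?u = mat 1" "elementary a b ?u ** elementary a b t = mat 1"
    unfolding elementary_mult using elementary_0 by metis+
  then show "invertible (elementary a b t)" unfolding invertible_def by blast
  show "matrix_inv (elementary a b t) = elementary a b ?u"
    by (rule matrix_inv_eqI[OF *])
qed

lemma elementary_mult_vec: "(elementary a b t *v x) $ k = x $ k + (if k = a then t * x $ b else 0)"
  using exhaust_3[of a] exhaust_3[of b] exhaust_3[of k]
  by (elim disjE) (simp_all add: elementary_def matrix_vector_mult_def sum_3 algebra_simps)

lemma vec_mult_elementary: "(x v* elementary a b t) $ k = x $ k + (if k = b then t * x $ a else 0)"
  using exhaust_3[of a] exhaust_3[of b] exhaust_3[of k]
  by (elim disjE) (simp_all add: elementary_def vector_matrix_mult_def sum_3 algebra_simps)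

text \<open>At weight zero the rescaling back into the chart has no effect, so the fractional action
  may be replaced by the linear one.\<close>

lemma eval_chart_act:
  assumes "finite I" "homogeneous I 0 P" "invertible T" "\<And>i. i \<in> I \<Longrightarrow> hscale T z i \<noteq> 0"
  shows "eval (chart (act T z)) P = eval (linact T z) P"
proof -
  have "eval (chart (act T z)) P = eval (rescale (\<lambda>i. 1 / hscale T z i) (linact T z)) P"
  proof (rule eval_cong)
    fix m v assume "m \<in> keys P" "v \<in> keys m"
    then have "v \<in> hvars I" using assms(2) by (auto simp: homogeneous_def)
    then show "chart (act T z) v = rescale (\<lambda>i. 1 / hscale T z i) (linact T z) v"
      using assms(3,4) by (auto simp: hvars_def chart_act)
  qed
  also have "\<dots> = (\<Prod>i\<in>I. (1 / hscale T z i) powi 0) * eval (linact T z) P"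
    by (rule eval_rescale[OF assms(1) _ assms(2)]) (use assms(4) in auto)
  finally show ?thesis by simp
qed

text \<open>Along the curve of elementary matrices \<open>P\<close> is constant near
  \<open>t = 0\<close>, so its derivative there, which is \<open>Dop I b a P\<close>,
  vanishes.\<close>

lemma eval_Dop_zero:
  assumes I: "finite I" and P: "homogeneous I 0 P"
    and inv: "\<And>T. invertible T \<Longrightarrow> (\<And>i. i \<in> I \<Longrightarrow> hscale T z i \<noteq> 0) \<Longrightarrow>
      eval (chart (act T z)) P = eval (chart z) P"
  shows "eval (chart z) (Dop I b a P) = 0"
proof -
  \<comment> \<open>The linear action of \<open>elementary a b t\<close> in explicit form, with
    \<open>\<phi>'\<close> its derivative at \<open>t = 0\<close>.\<close>
  define \<phi> where "\<phi> v t = (case v of Vec k i \<Rightarrow> pt z i $ k + (if k = a then t * pt z i $ b else 0)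
    | Cov k i \<Rightarrow> covec z i $ k + (if k = b then - t / (if a = b then 1 + t else 1) * covec z i $ a else 0))" for v t
  define \<phi>' where "\<phi>' v = (case v of Vec k i \<Rightarrow> (if k = a then pt z i $ b else 0)
    | Cov k i \<Rightarrow> (if k = b then - covec z i $ a else 0))" for v
  have linact: "(\<lambda>v. \<phi> v t) = linact (elementary a b t) z" if "1 + t \<noteq> 0" for t
    unfolding linact_def \<phi>_def matrix_inv_elementary(2)[OF that] elementary_mult_vec vec_mult_elementary
    by (simp cong: hvar.case_cong)
  have \<phi>0: "(\<lambda>v. \<phi> v 0) = chart z"
    by (auto simp: \<phi>_def chart_def split: hvar.split)
  have "(\<phi> v has_real_derivative \<phi>' v) (at 0)" for v
  proof (cases v)
    case (Vec k i)
    then have "\<phi> v = (\<lambda>t. pt z i $ k + (if k = a then t * pt z i $ b else 0))"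
      by (auto simp: \<phi>_def)
    then show ?thesis using Vec
      by (cases "k = a") (auto simp: \<phi>'_def intro!: derivative_eq_intros)
  next
    case (Cov k i)
    then have "\<phi> v = (\<lambda>t. covec z i $ k + (if k = b then - t / (if a = b then 1 + t else 1) * covec z i $ a else 0))"
      by (auto simp: \<phi>_def)
    then show ?thesis using Cov
      by (cases "k = b"; cases "a = b") (auto simp: \<phi>'_def intro!: derivative_eq_intros)
  qed
  then have "((\<lambda>t. eval (\<lambda>v. \<phi> v t) P) has_real_derivative
      (\<Sum>v\<in>hvars I. \<phi>' v * eval (\<lambda>v. \<phi> v 0) (pd v P))) (at 0)"
    using P I by (intro eval_has_derivative) (auto simp: homogeneous_def)
  also have "(\<Sum>v\<in>hvars I. \<phi>' v * eval (\<lambda>v. \<phi> v 0) (pd v P)) = eval (chart z) (Dop I b a P)"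
  proof -
    have "(\<Sum>k\<in>UNIV. \<Sum>i\<in>I. \<phi>' (Vec k i) * eval (chart z) (pd (Vec k i) P)) =
        (\<Sum>k\<in>UNIV. if k = a then (\<Sum>i\<in>I. pt z i $ b * eval (chart z) (pd (Vec k i) P)) else 0)"
      by (intro sum.cong) (auto simp: \<phi>'_def)
    moreover have "(\<Sum>k\<in>UNIV. \<Sum>i\<in>I. \<phi>' (Cov k i) * eval (chart z) (pd (Cov k i) P)) =
        (\<Sum>k\<in>UNIV. if k = b then - (\<Sum>i\<in>I. covec z i $ a * eval (chart z) (pd (Cov k i) P)) else 0)"
      by (intro sum.cong) (auto simp: \<phi>'_def sum_negf)
    ultimately show ?thesis
      by (simp add: sum_hvars[OF I] \<phi>0 Dop_def Xop_def Yop_def chart_def)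
  qed
  finally have deriv: "((\<lambda>t. eval (\<lambda>v. \<phi> v t) P) has_real_derivative eval (chart z) (Dop I b a P)) (at 0)" .
  \<comment> \<open>The scale is \<open>1\<close> at the identity, hence nonzero nearby; finitely
    many points share a neighbourhood.\<close>
  have "\<forall>\<^sub>F t in nhds 0. hscale (elementary a b t) z i \<noteq> 0" for i
  proof -
    have "((\<lambda>t. 1 + (if 3 = a then t * pt z i $ b else 0)) \<longlongrightarrow> 1 + (if 3 = a then 0 * pt z i $ b else 0)) (nhds 0)"
      by (cases "3 = a") (auto intro!: tendsto_eq_intros filterlim_ident)
    then have "\<forall>\<^sub>F t in nhds 0. 1 + (if 3 = a then t * pt z i $ b else 0) \<noteq> 0"
      by (rule tendsto_imp_eventually_ne) simp
    moreover have "hscale (elementary a b t) z i = 1 + (if 3 = a then t * pt z i $ b else 0)" for t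
      unfolding hscale_eq elementary_mult_vec by (simp add: pt_def)
    ultimately show ?thesis by simp
  qed
  then have "\<forall>\<^sub>F t in nhds 0. \<forall>i\<in>I. hscale (elementary a b t) z i \<noteq> 0"
    using I by (simp add: eventually_ball_finite)
  moreover have "((\<lambda>t. 1 + t) \<longlongrightarrow> 1 + 0) (nhds (0::real))"
    by (intro tendsto_intros filterlim_ident)
  then have "\<forall>\<^sub>F t in nhds 0. 1 + t \<noteq> (0::real)"
    by (rule tendsto_imp_eventually_ne) simp
  ultimately have "\<forall>\<^sub>F t in nhds 0. eval (\<lambda>v. \<phi> v t) P = eval (chart z) P"
  proof eventually_elim
    case (elim t)
    have "eval (\<lambda>v. \<phi> v t) P = eval (chart (act (elementary a b t) z)) P"
      using eval_chart_act[OF I P matrix_inv_elementary(1)[OF elim(2)]] elim linact by simp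
    also have "\<dots> = eval (chart z) P"
      by (rule inv[OF matrix_inv_elementary(1)[OF elim(2)]]) (use elim in simp)
    finally show ?case .
  qed
  then have "((\<lambda>t. eval (chart z) P) has_real_derivative eval (chart z) (Dop I b a P)) (at 0)"
    using iffD1[OF DERIV_cong_ev[OF refl _ refl] deriv] by simp
  then show ?thesis using DERIV_unique DERIV_const by blast
qed


section \<open>Generation by cyclic invariants\<close>

text \<open>\<open>E\<close> records the factors. All monomials of \<open>Q\<close> have the same
  degree, and their weight at a point is its in-degree minus its out-degree.\<close>

lemma pairing_monomial_edges:
  assumes "Q \<in> pairing_monomials {1..n}"
  shows "\<exists>E. set_mset E \<subseteq> {1..n} \<times> {1..n} \<and> (\<forall>z. eval (chart z) Q = eval z (edge_poly E)) \<and>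
    (\<forall>m\<in>keys Q. keys m \<subseteq> hvars {1..n} \<and> mdeg m = 2 * size E \<and>
      (\<forall>v. wt v m = int (count (image_mset snd E) v) - int (count (image_mset fst E) v)))"
  using assms
proof induction
  case one
  show ?case by (intro exI[of _ "{#}"]) (auto simp: edge_poly_def)
next
  case (mult Q i j)
  then obtain E where E: "set_mset E \<subseteq> {1..n} \<times> {1..n}" "\<And>z. eval (chart z) Q = eval z (edge_poly E)"
    "\<And>m. m \<in> keys Q \<Longrightarrow> keys m \<subseteq> hvars {1..n} \<and> mdeg m = 2 * size E \<and>
      (\<forall>v. wt v m = int (count (image_mset snd E) v) - int (count (image_mset fst E) v))"
    by blast
  have 1: "eval (chart z) (pairing i j * Q) = eval z (edge_poly (add_mset (i, j) E))" for z
    by (simp add: edge_poly_def eval_Cpoly pairing_def E(2)[unfolded edge_poly_def])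
  have 2: "keys m \<subseteq> hvars {1..n} \<and> mdeg m = 2 * size (add_mset (i, j) E) \<and>
      (\<forall>v. wt v m = int (count (image_mset snd (add_mset (i, j) E)) v) - int (count (image_mset fst (add_mset (i, j) E)) v))"
    if m: "m \<in> keys (pairing i j * Q)" for m
  proof -
    have "pairing i j * Q = (\<Sum>k\<in>UNIV. var (Cov k i) * (var (Vec k j) * Q))"
      by (simp add: pairing_def sum_distrib_right mult.assoc)
    then obtain k where "m \<in> keys (var (Cov k i) * (var (Vec k j) * Q))"
      using m keys_sum_subset_UN[of "\<lambda>k. var (Cov k i) * (var (Vec k j) * Q)" UNIV] by auto
    then obtain m' where m': "m' \<in> keys Q" "m = single (Cov k i) 1 + (single (Vec k j) 1 + m')"
      by (auto simp: keys_var_mult)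
    have "keys m \<subseteq> hvars {1..n}"
      using E(3)[OF m'(1)] mult.hyps keys_add[of "single (Cov k i) 1" "single (Vec k j) 1 + m'"]
        keys_add[of "single (Vec k j) 1" m'] unfolding m'(2) by fastforce
    then show ?thesis using E(3)[OF m'(1)] by (auto simp: m'(2))
  qed
  show ?case
    by (intro exI[of _ "add_mset (i, j) E"] conjI allI ballI 1 2) (use E(1) mult.hyps 2 in auto)
qed

lemma invariant_in_generated:
  assumes F: "F \<in> joint_invariants n"
  shows "F \<in> generated_subalgebra (cyclic_invariants n)"
proof -
  define I where "I = {1..n}"
  have I: "finite I" by (simp add: I_def)
  let ?A = "generated_subalgebra (cyclic_invariants n)"
  obtain P0 where P0: "homogeneous I 0 P0" "\<And>z. eval (chart z) P0 = eval z F"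
    using invariant_lift[OF F] unfolding I_def by blast
  define N where "N = Max (mdeg ` keys P0)"
  define M :: "(3 hvar \<Rightarrow>\<^sub>0 nat) set" where "M = balanced_monoms I N"
  have keys_P0: "keys P0 \<subseteq> M"
    using P0(1) by (auto simp: M_def balanced_monoms_def homogeneous_def N_def)
  \<comment> \<open>With \<open>G = 0\<close> this also contains every polynomial on
    \<open>M\<close> that vanishes on all charts.\<close>
  define U where "U = {Q. keys Q \<subseteq> M \<and> (\<exists>G\<in>?A. \<forall>z. eval (chart z) Q = eval z G)}"
  have zero_U: "Q \<in> U" if "keys Q \<subseteq> M" "\<And>z. eval (chart z) Q = 0" for Q
  proof -
    have "\<forall>z. eval (chart z) Q = eval z (pconst 0)" using that(2) by (simp add: pconst_def)
    then show ?thesis using that(1) generated_subalgebra.const unfolding U_def by blast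
  qed
  have "mpoly.subspace U"
  proof (rule mpoly.subspaceI)
    show "0 \<in> U" by (rule zero_U) auto
  next
    fix P Q assume "P \<in> U" "Q \<in> U"
    then obtain G H where "G \<in> ?A" "H \<in> ?A" "\<forall>z. eval (chart z) P = eval z G" "\<forall>z. eval (chart z) Q = eval z H"
      by (auto simp: U_def)
    then have "G + H \<in> ?A" "\<forall>z. eval (chart z) (P + Q) = eval z (G + H)"
      by (auto intro: generated_subalgebra.add)
    then show "P + Q \<in> U"
      using \<open>P \<in> U\<close> \<open>Q \<in> U\<close> keys_add[of P Q] unfolding U_def by blast
  next
    fix c and P :: "3 hvar mpoly" assume "P \<in> U"
    then obtain G where "G \<in> ?A" "\<forall>z. eval (chart z) P = eval z G"
      by (auto simp: U_def)
    then have "pconst c * G \<in> ?A" "\<forall>z. eval (chart z) (cst c * P) = eval z (pconst c * G)"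
      by (auto intro: generated_subalgebra.mult generated_subalgebra.const) (simp add: pconst_def)
    then show "cst c * P \<in> U"
      using \<open>P \<in> U\<close> keys_cst_mult[of c P] unfolding U_def by blast
  qed
  then obtain Pu where Pu: "Pu \<in> U" "\<And>Q. Q \<in> U \<Longrightarrow> fischer (P0 - Pu) Q = 0"
    using fischer_projection[of M U P0] finite_balanced_monoms[OF I, of N]
    unfolding M_def U_def by blast
  obtain G where G: "G \<in> ?A" "\<And>z. eval (chart z) Pu = eval z G"
    using Pu(1) by (auto simp: U_def)
  define P where "P = P0 - Pu"
  have keys_P: "keys P \<subseteq> M"
    using keys_P0 Pu(1) keys_diff_subset[of P0 Pu] by (auto simp: P_def U_def)
  have P_orth: "fischer P Q = 0" if "Q \<in> U" for Q
    using Pu(2)[OF that] by (simp add: P_def)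
  have Dop_M: "keys (Dop I k l Q) \<subseteq> M" if "keys Q \<subseteq> M" for k l Q
    using that unfolding M_def by (rule keys_Dop_balanced)
  have hom_M: "homogeneous I 0 Q" if "keys Q \<subseteq> M" for Q
    using that unfolding M_def by (rule homogeneous_balanced)
  have P_inv: "eval (chart (act T z)) P = eval (chart z) P"
    if "invertible T" "\<And>i. i \<in> I \<Longrightarrow> hscale T z i \<noteq> 0" for T z
    using joint_invariantsD[OF F that(1)] eval_generated_act[OF G(1) that(1)] that(2)
    by (simp add: P_def P0(2) G(2) I_def)
  have Dop_P: "eval (chart z) (Dop I k l P) = 0" for k l z
    by (rule eval_Dop_zero[OF I]) (use P_inv hom_M[OF keys_P] in auto)
  have "Dop I k l P = 0" for k l
  proof -
    let ?D = "Dop I k l P"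
    \<comment> \<open>\<open>?D\<close> vanishes on all charts, which is trivially invariant, so
      applying the adjoint operator stays in the kernel of the restriction and thus in
      \<open>U\<close>.\<close>
    have "eval (chart z) (Dop I l k ?D) = 0" for z
      by (rule eval_Dop_zero[OF I])
        (use Dop_P hom_M[OF Dop_M[OF keys_P]] in auto)
    then have "Dop I l k ?D \<in> U"
      by (intro zero_U Dop_M keys_P)
    then have "fischer ?D ?D = 0"
      unfolding fischer_Dop[of I k l P] by (rule P_orth)
    then show ?thesis by (rule fischer_eq_0)
  qed
  moreover have "fischer P Q = 0" if Q: "Q \<in> pairing_monomials I" for Q
  proof -
    obtain E where E: "set_mset E \<subseteq> {1..n} \<times> {1..n}" "\<And>z. eval (chart z) Q = eval z (edge_poly E)"
      "\<And>m. m \<in> keys Q \<Longrightarrow> keys m \<subseteq> hvars {1..n} \<and> mdeg m = 2 * size E \<and>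
        (\<forall>v. wt v m = int (count (image_mset snd E) v) - int (count (image_mset fst E) v))"
      using pairing_monomial_edges[of Q n] Q unfolding I_def by blast
    show ?thesis
    \<comment> \<open>Degree and weights are common to all monomials of \<open>Q\<close>, so its
      support either misses \<open>M\<close>, and orthogonality is immediate, or lies inside
      \<open>M\<close>, and the edges are balanced.\<close>
    proof (cases "keys Q \<inter> M = {}")
      case True
      then have "lookup P m * lookup Q m = 0" if "m \<in> keys P" for m
        using that keys_P not_in_keys_iff_lookup_eq_zero[of m Q] by auto
      then show ?thesis unfolding fischer_def by (intro sum.neutral ballI) simp
    next
      case False
      then obtain m where m: "m \<in> keys Q" "m \<in> M" by blast
      have "count (image_mset fst E) v = count (image_mset snd E) v" for v
      proof (cases "v \<in> I")
        case True
        then show ?thesis using m E(3)[OF m(1)] by (simp add: M_def balanced_monoms_def)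
      next
        case False
        then have "v \<notin># image_mset fst E" "v \<notin># image_mset snd E"
          using E(1) by (auto simp: I_def)
        then show ?thesis by (metis count_eq_zero_iff)
      qed
      then have bal: "image_mset fst E = image_mset snd E" by (rule multiset_eqI)
      have "2 * size E \<le> N" using E(3)[OF m(1)] m(2) by (simp add: M_def balanced_monoms_def)
      then have "keys Q \<subseteq> M"
        using E(3) by (auto simp: M_def balanced_monoms_def bal I_def)
      then have "Q \<in> U"
        using E(2) balanced_edge_poly[OF bal E(1)] unfolding U_def by blast
      then show ?thesis by (rule P_orth)
    qed
  qed
  moreover have "keys m \<subseteq> hvars I" if "m \<in> keys P" for m
    using keys_P that by (auto simp: M_def balanced_monoms_def)
  ultimately have "P = 0"
    by (intro invariant_orthogonal_pairings[OF I]) (auto simp: Dop_def)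
  then have "eval z (F - G) = 0" for z
    using P0(2)[of z] G(2)[of z] by (simp add: P_def)
  then have "F - G = 0" by (rule eval_zero_imp_zero)
  then show ?thesis using G(1) by simp
qed

theorem theorem2p2:
  fixes n :: nat
  assumes "n \<ge> 3"
  shows "joint_invariants n = generated_subalgebra (cyclic_invariants n)"
  using generated_subset_invariants invariant_in_generated by blast

end
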